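(* Let $d\ge 2$ and $0\le d-2<s<d$. Let $R_1>0$ with $R_1^d\in\mathbb N$, and let $\nu_{R_1}$ be an $(R_1\mathbb Z)^d$-periodic configuration of points in $\mathbb R^d$ (pairwise distinct, so that the energies below are defined) having $R_1^d$ points per fundamental domain and satisfying $\int_{K_{R_1}}x\,d\nu_{R_1}(x)=0$. Then, with limits taken along $R$ such that $N=R^d\in\mathbb N$ and $R/R_1\in\mathbb N$, $$\lim_{\substack{N=R^d\to\infty\\R/R_1\in\mathbb N}}\frac{E_{\mathrm{UEG},s}(\mu_{K_R},\nu_{R_1}|_{K_R})-E_{\mathrm{Jel},s}(\mu_{K_R},\nu_{R_1}|_{K_R})}{N}=\frac{2}{|K_{R_1}|}\int_{\mathbb R^d}h^{\nu_{R_1}|_{K_{R_1}}-\mu_{K_{R_1}}}(x)\,dx$$ and $$\lim_{\substack{N=R^d\to\infty\\R/R_1\in\mathbb N}}\frac{E_{\mathrm{UEG},s}(\mu_{N,R_1},\nu_{R_1}|_{K_R})-E_{\mathrm{UEG},s}(\mu_{K_R},\nu_{R_1}|_{K_R})}{N}=\frac1{|K_{R_1}|}\int_{\mathbb R^d}h^{(\delta_0-\nu^1_{R_1}*\nu^1_{R_1})*\mu_{K_{R_1}}}(x)\,dx.$$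
   Context: $K_R=[-R/2,R/2)^d$ and $d\mu_{K_R}(x)=1_{K_R}(x)dx$. A configuration is a locally finite sum of Dirac masses $\nu=\sum_{p\in\mathsf{set}(\nu)}\delta_p$. For a finite positive measure $\mu$ with $\iint|x-y|^{-s}d\mu\,d\mu<\infty$ and a configuration $\nu$ with finitely many distinct points, $$E_{\mathrm{Jel},s}(\mu,\nu)=\sum_{p\ne q\in\mathsf{set}(\nu)}|p-q|^{-s}-2\sum_{p\in\mathsf{set}(\nu)}\int|p-y|^{-s}d\mu(y)+\iint|x-y|^{-s}d\mu(x)d\mu(y),$$ $$E_{\mathrm{UEG},s}(\mu,\nu)=\sum_{p\ne q\in\mathsf{set}(\nu)}|p-q|^{-s}-\iint|x-y|^{-s}d\mu(x)d\mu(y).$$ For a (signed) measure $\lambda$, $h^\lambda(x)=\int|x-x'|^{-s}d\lambda(x')$. Moreover $$\mu_{N,R_1}=\frac1{|K_{R_1}|}\int_{K_{R_1}}\sum_{p\in\mathsf{set}(\nu_{R_1})\cap K_R}\delta_{p+x}\,dx,\qquad \nu^1_{R_1}=\frac1{|K_{R_1}|}\sum_{p\in\mathsf{set}(\nu_{R_1})\cap K_{R_1}}\delta_p .$$ *)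

theory Defs
  imports "HOL-Probability.Convolution"
begin

definition cube :: "real \<Rightarrow> (real ^ 'n::finite) set" where
  "cube R = {x. \<forall>i. - (R / 2) \<le> x $ i \<and> x $ i < R / 2}"

definition cube_measure :: "real \<Rightarrow> (real ^ 'n::finite) measure" where
  "cube_measure R = density lborel (indicator (cube R))"

(* The value at 0 is 0 (because 0 powr a = 0) instead of infinity.  This is harmless below: the
   diagonal is excluded from the sums over points, and it is a null set in every double integral
   and for almost every x in every potential.  The energies are meant for finite measures mu of
   finite energy, which have no atoms. *)
definition riesz :: "real \<Rightarrow> real ^ 'n::finite \<Rightarrow> real" where
  "riesz s x = norm x powr (- s)"

(* A configuration of pairwise distinct points is identified with set(nu), a locally finite set;
   the measure itself is dirac_sum, and restriction to K corresponds to intersection with K. *)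
definition configuration :: "(real ^ 'n::finite) set \<Rightarrow> bool" where
  "configuration P \<longleftrightarrow> (\<forall>B. bounded B \<longrightarrow> finite (P \<inter> B))"

(* emeasure (dirac_sum P) A is the number of points of P in A. *)
definition dirac_sum :: "(real ^ 'n::finite) set \<Rightarrow> (real ^ 'n) measure" where
  "dirac_sum P = distr (count_space P) borel (\<lambda>p. p)"

lemma emeasure_dirac_sum:
  assumes "A \<in> sets borel"
  shows "emeasure (dirac_sum P) A = emeasure (count_space P) (P \<inter> A)"
  unfolding dirac_sum_def using assms
  by (subst emeasure_distr) (auto intro!: arg_cong[where f = "emeasure (count_space P)"])

lemma emeasure_dirac_sum_finite:
  assumes "finite P" "A \<in> sets borel"
  shows "emeasure (dirac_sum P) A = (\<Sum>p\<in>P. emeasure (return borel p) A)"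
  using assms
  by (simp add: emeasure_dirac_sum emeasure_count_space indicator_def sum.If_cases Int_def
        flip: of_nat_sum)

definition scaled_lattice :: "real \<Rightarrow> (real ^ 'n::finite) set" where
  "scaled_lattice R = {R *\<^sub>R z | z. \<forall>i. z $ i \<in> \<int>}"

definition lattice_periodic :: "real \<Rightarrow> (real ^ 'n::finite) set \<Rightarrow> bool" where
  "lattice_periodic R P \<longleftrightarrow> (\<forall>v \<in> scaled_lattice R. (\<lambda>p. p + v) ` P = P)"

definition self_energy :: "real \<Rightarrow> (real ^ 'n::finite) measure \<Rightarrow> real" where
  "self_energy s \<mu> = (\<integral>z. riesz s (fst z - snd z) \<partial>(\<mu> \<Otimes>\<^sub>M \<mu>))"

definition point_energy :: "real \<Rightarrow> (real ^ 'n::finite) set \<Rightarrow> real" where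
  "point_energy s P = (\<Sum>p\<in>P. \<Sum>q\<in>P - {p}. riesz s (p - q))"

definition E_Jel :: "real \<Rightarrow> (real ^ 'n::finite) measure \<Rightarrow> (real ^ 'n) set \<Rightarrow> real" where
  "E_Jel s \<mu> P =
     point_energy s P - 2 * (\<Sum>p\<in>P. \<integral>y. riesz s (p - y) \<partial>\<mu>) + self_energy s \<mu>"

definition E_UEG :: "real \<Rightarrow> (real ^ 'n::finite) measure \<Rightarrow> (real ^ 'n) set \<Rightarrow> real" where
  "E_UEG s \<mu> P = point_energy s P - self_energy s \<mu>"

(* The signed measure M1 - M2, for finite M1 and M2, is represented by the pair (M1, M2).  Both
   operations on pairs are (bi)linear, so that they do not depend on the chosen decomposition
   (for the potential: at all points where the potentials of M1 and M2 are finite). *)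
type_synonym 'a signed_measure = "'a measure \<times> 'a measure"

definition potential :: "real \<Rightarrow> (real ^ 'n::finite) signed_measure \<Rightarrow> real ^ 'n \<Rightarrow> real" where
  "potential s \<sigma> x =
     (\<integral>y. riesz s (x - y) \<partial>(fst \<sigma>)) - (\<integral>y. riesz s (x - y) \<partial>(snd \<sigma>))"

definition signed_convolution ::
  "(real ^ 'n::finite) signed_measure \<Rightarrow> (real ^ 'n) measure \<Rightarrow> (real ^ 'n) signed_measure" where
  "signed_convolution \<sigma> M = (fst \<sigma> \<star> M, snd \<sigma> \<star> M)"

definition normalized_cell :: "real \<Rightarrow> (real ^ 'n::finite) set \<Rightarrow> (real ^ 'n) measure" where
  "normalized_cell R1 P =
     scale_measure (1 / emeasure lborel (cube R1 :: (real ^ 'n) set)) (dirac_sum (P \<inter> cube R1))"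

(* The average over x in cube R1 of the measures sum_{p in P \<inter> cube R} delta_{p + x}, given by
   its values on Borel sets; see emeasure_averaged_measure. *)
definition averaged_measure ::
  "real \<Rightarrow> real \<Rightarrow> (real ^ 'n::finite) set \<Rightarrow> (real ^ 'n) measure" where
  "averaged_measure R R1 P = measure_of UNIV (sets borel)
     (\<lambda>A. (1 / emeasure lborel (cube R1 :: (real ^ 'n) set)) *
        (\<integral>\<^sup>+x\<in>cube R1. (\<Sum>p\<in>P \<inter> cube R. emeasure (return borel (p + x)) A) \<partial>lborel))"

lemma sets_cube [measurable]: "(cube R :: (real ^ 'n::finite) set) \<in> sets borel"
proof -
  have "(cube R :: (real ^ 'n) set) =
      (\<Inter>i. {x. - (R / 2) \<le> x $ i} \<inter> {x. x $ i < R / 2})"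
    by (auto simp: cube_def)
  moreover have "{x :: real ^ 'n. - (R / 2) \<le> x $ i} \<inter> {x. x $ i < R / 2} \<in> sets borel" for i
    by (intro sets.Int borel_closed borel_open closed_Collect_le open_Collect_less
        continuous_intros)
  ultimately show ?thesis
    by (auto intro!: sets.countable_INT)
qed

lemma emeasure_averaged_measure:
  fixes P :: "(real ^ 'n::finite) set"
  assumes A: "A \<in> sets borel"
  shows "emeasure (averaged_measure R R1 P) A =
    (1 / emeasure lborel (cube R1 :: (real ^ 'n) set)) *
      (\<integral>\<^sup>+x\<in>cube R1. (\<Sum>p\<in>P \<inter> cube R. emeasure (return borel (p + x)) A) \<partial>lborel)"
  unfolding averaged_measure_def
proof (rule emeasure_measure_of_sigma)
  show "sigma_algebra (UNIV :: (real ^ 'n) set) (sets borel)"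
    by (metis sets.sigma_algebra_axioms space_borel)
  let ?f = "\<lambda>A x. (\<Sum>p\<in>P \<inter> cube R. emeasure (return borel (p + x)) A) * indicator (cube R1) x"
  have meas: "?f B \<in> borel_measurable lborel" if [measurable]: "B \<in> sets borel"
    for B :: "(real ^ 'n) set"
    by simp
  show "positive (sets borel)
     (\<lambda>A. (1 / emeasure lborel (cube R1 :: (real ^ 'n) set)) * (\<integral>\<^sup>+x. ?f A x \<partial>lborel))"
    by (auto simp: positive_def)
  show "countably_additive (sets borel)
     (\<lambda>A. (1 / emeasure lborel (cube R1 :: (real ^ 'n) set)) * (\<integral>\<^sup>+x. ?f A x \<partial>lborel))"
  proof (rule countably_additiveI)
    fix B :: "nat \<Rightarrow> (real ^ 'n) set"
    assume B: "range B \<subseteq> sets borel" "disjoint_family B" "\<Union> (range B) \<in> sets borel"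
    have "(\<Sum>i. ?f (B i) x) = ?f (\<Union> (range B)) x" for x
    proof -
      have "(\<Sum>i. ?f (B i) x) =
          (\<Sum>i. (\<Sum>p\<in>P \<inter> cube R. emeasure (return borel (p + x)) (B i))) * indicator (cube R1) x"
        by simp
      also have "(\<Sum>i. (\<Sum>p\<in>P \<inter> cube R. emeasure (return borel (p + x)) (B i))) =
          (\<Sum>p\<in>P \<inter> cube R. \<Sum>i. emeasure (return borel (p + x)) (B i))"
        by (rule suminf_sum) simp
      also have "\<dots> = (\<Sum>p\<in>P \<inter> cube R. emeasure (return borel (p + x)) (\<Union> (range B)))"
        by (intro sum.cong refl suminf_emeasure) (use B in auto)
      finally show ?thesis .
    qed
    moreover have "(\<integral>\<^sup>+x. (\<Sum>i. ?f (B i) x) \<partial>lborel) = (\<Sum>i. \<integral>\<^sup>+x. ?f (B i) x \<partial>lborel)"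
      by (rule nn_integral_suminf) (use B meas in auto)
    ultimately show "(\<Sum>i. (1 / emeasure lborel (cube R1 :: (real ^ 'n) set)) * (\<integral>\<^sup>+x. ?f (B i) x \<partial>lborel))
        = (1 / emeasure lborel (cube R1 :: (real ^ 'n) set)) * (\<integral>\<^sup>+x. ?f (\<Union> (range B)) x \<partial>lborel)"
      by simp
  qed
qed (use A in auto)

(* R tends to infinity along the R with R^d and R / R1 natural numbers. *)
definition admissible_at_top :: "'n::finite itself \<Rightarrow> real \<Rightarrow> real filter" where
  "admissible_at_top _ R1 = inf at_top (principal {R. R ^ CARD('n) \<in> \<nat> \<and> R / R1 \<in> \<nat>})"

lemma admissible_at_top_nontrivial:
  assumes "R1 > 0" "R1 ^ CARD('n::finite) \<in> \<nat>"
  shows "admissible_at_top TYPE('n) R1 \<noteq> bot"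
proof
  assume "admissible_at_top TYPE('n) R1 = bot"
  then have "\<forall>\<^sub>F R in at_top. \<not> (R ^ CARD('n) \<in> \<nat> \<and> R / R1 \<in> \<nat>)"
    by (simp add: trivial_limit_def admissible_at_top_def eventually_inf_principal)
  then obtain b where b: "\<And>R. R \<ge> b \<Longrightarrow> \<not> (R ^ CARD('n) \<in> \<nat> \<and> R / R1 \<in> \<nat>)"
    by (auto simp: eventually_at_top_linorder)
  obtain k :: nat where "b / R1 < real k"
    using reals_Archimedean2 by blast
  then have "real k * R1 \<ge> b"
    using assms by (simp add: field_simps)
  moreover have "(real k * R1) ^ CARD('n) \<in> \<nat>" "real k * R1 / R1 \<in> \<nat>"
    using assms by (simp_all add: power_mult_distrib flip: of_nat_power)
  ultimately show False
    using b by blast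
qed

end

theory Submission
  imports Defs
begin

text \<open>Write \<open>g = riesz s\<close>. The integral over \<open>x\<close> of the second difference
  \<open>g (x + y) + g (x - y) - 2 * g x\<close> converges absolutely because \<open>d - 2 < s < d\<close>; as a function
  of \<open>y\<close> it is homogeneous of degree \<open>d - s < 2\<close> and satisfies \<open>I (2 * y) = 4 * I y\<close>, so it vanishes.
  Consequently the potential of a neutral, dipole-free measure of bounded support is integrable with
  integral \<open>0\<close>, and it remains to see that both sequences tend to \<open>0\<close>.

  Both energy differences, divided by the number of points, are combinations with total weight \<open>0\<close> of
  values of \<open>T y\<close>, the mean over the \<open>k ^ d\<close> cell centres \<open>z\<close> of the potential of the large cube at
  \<open>z + y\<close>. Since \<open>T\<close> is even, \<open>T y - T 0\<close> is half the integral of the second difference against a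
  weight in \<open>[0, 1]\<close> that tends to \<open>1\<close> pointwise, and dominated convergence applies. For even \<open>k\<close> the
  cells tiling the large cube are not lattice translates of the cell in the hypothesis and may carry
  a dipole; evenness of \<open>T\<close> makes this harmless.\<close>

section \<open>Integrability of powers of the norm\<close>

text \<open>The kernel is not integrable at infinity, so integration over space cannot be exchanged
  directly with integration against a source measure. Far from the sources an expansion to first
  order in the source point is therefore subtracted: the remainder decays like
  \<open>norm x powr (- s - 2)\<close>, which is integrable because \<open>s > d - 2\<close>, and
  the subtracted terms see only mass and first moment. The same obstacle governs the energies: a
  first difference decays only like \<open>norm x powr (- s - 1)\<close>, too slowly when
  \<open>s \<le> d - 1\<close>, so the symmetry of \<open>T\<close> has to be used before any limit
  is taken. The total weight is 0 because the number of points per cell equals the volume of the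
  cell. This cancellation is essential, since \<open>T 0\<close> itself grows without bound with the
  large cube.\<close>

lemma lborel_nn_integral_affine:
  fixes f :: "'a::euclidean_space \<Rightarrow> ennreal"
  assumes [measurable]: "f \<in> borel_measurable borel" and c: "c \<noteq> 0"
  shows "(\<integral>\<^sup>+x. f x \<partial>lborel) = ennreal (\<bar>c\<bar> ^ DIM('a)) * (\<integral>\<^sup>+x. f (t + c *\<^sub>R x) \<partial>lborel)"
  by (subst lborel_affine[OF c, of t])
     (simp add: nn_integral_density nn_integral_distr nn_integral_cmult)

lemma lborel_integral_affine:
  fixes f :: "'a::euclidean_space \<Rightarrow> 'b::{banach, second_countable_topology}"
  assumes [measurable]: "f \<in> borel_measurable borel" and c: "c \<noteq> 0"
  shows "(\<integral>x. f x \<partial>lborel) = \<bar>c\<bar> ^ DIM('a) *\<^sub>R (\<integral>x. f (t + c *\<^sub>R x) \<partial>lborel)"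
  by (subst lborel_affine[OF c, of t])
     (simp add: integral_density integral_distr)

lemma lborel_integrable_affine:
  fixes f :: "'a::euclidean_space \<Rightarrow> 'b::{banach, second_countable_topology}"
  assumes f: "integrable lborel f" and c: "c \<noteq> 0"
  shows "integrable lborel (\<lambda>x. f (t + c *\<^sub>R x))"
proof -
  have [measurable]: "f \<in> borel_measurable borel"
    using f by auto
  have "(\<integral>\<^sup>+x. ennreal (norm (f x)) \<partial>lborel) < \<infinity>"
    using f by (simp add: integrable_iff_bounded)
  then have "(\<integral>\<^sup>+x. ennreal (norm (f (t + c *\<^sub>R x))) \<partial>lborel) < \<infinity>"
    using c by (subst (asm) lborel_nn_integral_affine[where c = c and t = t])
      (auto simp: ennreal_mult_less_top)
  then show ?thesis
    by (intro integrableI_bounded) auto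
qed

text \<open>Dyadic balls shrinking to the origin: between two consecutive radii the power is at most
  its value at the inner one, and the contributions form a geometric series of ratio
  \<open>(1/2) powr (DIM('a) - a)\<close>, below 1 since \<open>a < DIM('a)\<close>. Full balls in
  place of shells cost only a constant factor.\<close>

lemma powr_norm_integrable_near:
  fixes a r :: real
  assumes "a > 0" "a < DIM('a::euclidean_space)" "r > 0"
  shows "integrable lborel (\<lambda>x::'a. indicator (ball 0 r) x * norm x powr (- a))"
proof (rule integrableI_bounded)
  let ?f = "\<lambda>x::'a. indicator (ball 0 r) x * norm x powr (- a)"
  let ?R = "\<lambda>k::nat. r * (1/2) ^ k"
  let ?v = "unit_ball_vol (DIM('a))"
  let ?g = "\<lambda>k (x::'a). ennreal (?R (Suc k) powr (- a)) * indicator (ball 0 (?R k)) x"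
  have [measurable]: "(\<lambda>x::'a. norm x powr (- a)) \<in> borel_measurable borel"
    unfolding powr_def by measurable
  show "?f \<in> borel_measurable lborel"
    by (intro borel_measurable_times borel_measurable_indicator) auto
  have "ennreal (norm (?f x)) \<le> (\<Sum>k. ?g k x)" for x
  proof (cases "x = 0 \<or> norm x \<ge> r")
    case True
    then show ?thesis by auto
  next
    case False
    then have x: "norm x > 0" "norm x < r" by auto
    have "(\<lambda>k. ?R k) \<longlonglongrightarrow> r * 0"
      by (intro tendsto_mult LIMSEQ_power_zero) auto
    then have "\<forall>\<^sub>F k in sequentially. ?R k < norm x"
      by (rule order_tendstoD(2)) (use x in simp)
    then obtain k0 where k0: "?R k0 < norm x"
      by (metis eventually_sequentially order_refl)
    then have "\<exists>k. ?R k \<le> norm x"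
      by (intro exI[of _ k0]) simp
    \<comment> \<open>The first radius not exceeding \<open>norm x\<close>. Its predecessor, of
      index \<open>m\<close>, does exceed it, so \<open>x\<close> lies in the ball of
      \<open>?g m\<close>, whose constant dominates the power.\<close>
    then obtain k where k: "?R k \<le> norm x" "\<And>j. j < k \<Longrightarrow> \<not> ?R j \<le> norm x"
      unfolding exists_least_iff[of "\<lambda>k. ?R k \<le> norm x"] by blast
    have "k \<noteq> 0"
      using k(1) x by (cases k) auto
    then obtain m where m: "k = Suc m"
      by (cases k) auto
    have "0 < ?R (Suc m)"
      using assms(3) by simp
    then have "norm x powr (- a) \<le> ?R (Suc m) powr (- a)"
      using k(1) m assms(1) by (intro powr_mono2') auto
    then have "ennreal (norm (?f x)) \<le> ?g m x"
      using k(2)[of m] m x by (auto simp: ennreal_leI)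
    also have "\<dots> = (\<Sum>k\<in>{m}. ?g k x)"
      by (simp only: sum.insert[OF finite.emptyI] empty_iff not_False_eq_True sum.empty add_0_right)
    also have "\<dots> \<le> (\<Sum>k. ?g k x)"
      by (rule sum_le_suminf) auto
    finally show ?thesis .
  qed
  then have "(\<integral>\<^sup>+x. ennreal (norm (?f x)) \<partial>lborel) \<le> (\<integral>\<^sup>+x. (\<Sum>k. ?g k x) \<partial>lborel)"
    by (intro nn_integral_mono) auto
  also have "\<dots> = (\<Sum>k. \<integral>\<^sup>+x. ?g k x \<partial>lborel)"
    by (rule nn_integral_suminf) (intro borel_measurable_times_ennreal borel_measurable_const borel_measurable_indicator; simp)
  also have "\<dots> \<le> (\<Sum>k. ennreal ((r / 2) powr (- a) * (?v * r ^ DIM('a)) * ((1/2) powr (DIM('a) - a)) ^ k))"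
  proof (rule suminf_le[OF _ summableI summableI])
    fix k
    have "(\<integral>\<^sup>+x. ?g k x \<partial>lborel) = ennreal (?R (Suc k) powr (- a)) * emeasure lborel (ball (0::'a) (?R k))"
      by (rule nn_integral_cmult_indicator) simp
    also have "\<dots> = ennreal (?R (Suc k) powr (- a)) * ennreal (?v * ?R k ^ DIM('a))"
      using \<open>r > 0\<close> by (subst emeasure_ball) simp_all
    also have "\<dots> = ennreal (?R (Suc k) powr (- a) * (?v * ?R k ^ DIM('a)))"
      using \<open>r > 0\<close> by (subst ennreal_mult) simp_all
    also have "?R (Suc k) powr (- a) * (?v * ?R k ^ DIM('a))
        = (r / 2) powr (- a) * (?v * r ^ DIM('a)) * ((1/2) powr (DIM('a) - a)) ^ k"
    proof -
      have "?R (Suc k) = (r / 2) * (1/2) ^ k"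
        by simp
      then have "?R (Suc k) powr (- a) = ((r / 2) * (1/2) ^ k) powr (- a)"
        by (rule arg_cong)
      also have "\<dots> = (r / 2) powr (- a) * ((1/2) ^ k) powr (- a)"
        using assms by (subst powr_mult) auto
      also have "((1/2::real) ^ k) powr (- a) = ((1/2) powr (- a)) ^ k"
        by (simp add: powr_realpow[symmetric] powr_powr mult.commute)
      finally have 1: "?R (Suc k) powr (- a) = (r / 2) powr (- a) * ((1/2) powr (- a)) ^ k" .
      have 2: "(1/2::real) powr (DIM('a) - a) = (1/2) powr (- a) * (1/2) ^ DIM('a)"
        by (simp add: powr_realpow[symmetric] powr_add[symmetric])
      show ?thesis
        unfolding 1 2 by (simp add: power_mult_distrib power_mult[symmetric] mult_ac)
    qed
    finally show "(\<integral>\<^sup>+x. ?g k x \<partial>lborel)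
        \<le> ennreal ((r / 2) powr (- a) * (?v * r ^ DIM('a)) * ((1/2) powr (DIM('a) - a)) ^ k)" by (rule eq_refl)
  qed
  also have "\<dots> < \<infinity>"
  proof -
    have "(1/2::real) powr (DIM('a) - a) < 1"
      using assms by (subst powr01_less_one) auto
    then have "summable (\<lambda>k. (r / 2) powr (- a) * (?v * r ^ DIM('a)) * ((1/2) powr (DIM('a) - a)) ^ k)"
      by (intro summable_mult summable_geometric) auto
    then show ?thesis
      unfolding infinity_ennreal_def less_top[symmetric]
      by (rule ennreal_suminf_neq_top) (use \<open>r > 0\<close> in simp)
  qed
  finally show "(\<integral>\<^sup>+x. ennreal (norm (?f x)) \<partial>lborel) < \<infinity>" .
qed

text \<open>The mirror image of the dyadic argument near the origin: the radii double, and the ratio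
  \<open>2 powr (DIM('a) - a)\<close> is below 1 since now \<open>a > DIM('a)\<close>.\<close>

lemma powr_norm_integrable_far:
  fixes a r :: real
  assumes "a > DIM('a::euclidean_space)" "r > 0"
  shows "integrable lborel (\<lambda>x::'a. indicator (- ball 0 r) x * norm x powr (- a))"
proof (rule integrableI_bounded)
  let ?f = "\<lambda>x::'a. indicator (- ball 0 r) x * norm x powr (- a)"
  let ?R = "\<lambda>k::nat. r * 2 ^ k"
  let ?v = "unit_ball_vol (DIM('a))"
  let ?g = "\<lambda>k (x::'a). ennreal (?R k powr (- a)) * indicator (ball 0 (?R (Suc k))) x"
  have [measurable]: "(\<lambda>x::'a. norm x powr (- a)) \<in> borel_measurable borel"
    unfolding powr_def by measurable
  show "?f \<in> borel_measurable lborel"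
    by (intro borel_measurable_times borel_measurable_indicator) auto
  have a: "a > 0"
    using assms(1) by (meson le_less_trans of_nat_0_le_iff)
  have "ennreal (norm (?f x)) \<le> (\<Sum>k. ?g k x)" for x
  proof (cases "norm x < r")
    case True
    then show ?thesis by auto
  next
    case False
    then have x: "norm x \<ge> r" by auto
    have "filterlim (\<lambda>k. ?R k) at_top sequentially"
      using assms(2) by real_asymp
    then have "\<forall>\<^sub>F k in sequentially. ?R k > norm x"
      by (simp add: filterlim_at_top_dense)
    then obtain k0 where k0: "?R k0 > norm x"
      by (metis eventually_sequentially order_refl)
    then have "\<exists>k. ?R k > norm x"
      by (intro exI[of _ k0]) simp
    then obtain k where k: "?R k > norm x" "\<And>j. j < k \<Longrightarrow> \<not> ?R j > norm x"
      unfolding exists_least_iff[of "\<lambda>k. ?R k > norm x"] by blast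
    have "k \<noteq> 0"
      using k(1) x by (cases k) auto
    then obtain m where m: "k = Suc m"
      by (cases k) auto
    have "0 < ?R m"
      using assms(2) by simp
    then have "norm x powr (- a) \<le> ?R m powr (- a)"
      using k(2)[of m] m a by (intro powr_mono2') auto
    then have "ennreal (norm (?f x)) \<le> ?g m x"
      using k(1) m x by (auto simp: ennreal_leI)
    also have "\<dots> = (\<Sum>k\<in>{m}. ?g k x)"
      by (simp only: sum.insert[OF finite.emptyI] empty_iff not_False_eq_True sum.empty add_0_right)
    also have "\<dots> \<le> (\<Sum>k. ?g k x)"
      by (rule sum_le_suminf) auto
    finally show ?thesis .
  qed
  then have "(\<integral>\<^sup>+x. ennreal (norm (?f x)) \<partial>lborel) \<le> (\<integral>\<^sup>+x. (\<Sum>k. ?g k x) \<partial>lborel)"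
    by (intro nn_integral_mono) auto
  also have "\<dots> = (\<Sum>k. \<integral>\<^sup>+x. ?g k x \<partial>lborel)"
    by (rule nn_integral_suminf) (intro borel_measurable_times_ennreal borel_measurable_const borel_measurable_indicator; simp)
  also have "\<dots> \<le> (\<Sum>k. ennreal (r powr (- a) * (?v * (2 * r) ^ DIM('a)) * (2 powr (DIM('a) - a)) ^ k))"
  proof (rule suminf_le[OF _ summableI summableI])
    fix k
    have "(\<integral>\<^sup>+x. ?g k x \<partial>lborel) = ennreal (?R k powr (- a)) * emeasure lborel (ball (0::'a) (?R (Suc k)))"
      by (rule nn_integral_cmult_indicator) simp
    also have "\<dots> = ennreal (?R k powr (- a)) * ennreal (?v * ?R (Suc k) ^ DIM('a))"
      using \<open>r > 0\<close> by (subst emeasure_ball) simp_all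
    also have "\<dots> = ennreal (?R k powr (- a) * (?v * ?R (Suc k) ^ DIM('a)))"
      using \<open>r > 0\<close> by (subst ennreal_mult) simp_all
    also have "?R k powr (- a) * (?v * ?R (Suc k) ^ DIM('a))
        = r powr (- a) * (?v * (2 * r) ^ DIM('a)) * (2 powr (DIM('a) - a)) ^ k"
    proof -
      have "?R k powr (- a) = r powr (- a) * (2 ^ k) powr (- a)"
        using assms by (subst powr_mult) auto
      also have "(2 ^ k) powr (- a) = (2 powr (- a)) ^ k"
        by (simp add: powr_realpow[symmetric] powr_powr mult.commute)
      finally have 1: "?R k powr (- a) = r powr (- a) * (2 powr (- a)) ^ k" .
      have "(2::real) ^ (k * DIM('a)) = (2 ^ DIM('a)) ^ k"
        by (metis power_mult mult.commute)
      then have 3: "?R (Suc k) ^ DIM('a) = (2 * r) ^ DIM('a) * (2 ^ DIM('a)) ^ k"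
        by (simp add: power_mult_distrib power_mult[symmetric])
      have 2: "(2::real) powr (DIM('a) - a) = 2 powr (- a) * 2 ^ DIM('a)"
        by (simp add: powr_realpow[symmetric] powr_add[symmetric])
      show ?thesis
        unfolding 1 2 3 by (simp add: power_mult_distrib)
    qed
    finally show "(\<integral>\<^sup>+x. ?g k x \<partial>lborel)
        \<le> ennreal (r powr (- a) * (?v * (2 * r) ^ DIM('a)) * (2 powr (DIM('a) - a)) ^ k)" by (rule eq_refl)
  qed
  also have "\<dots> < \<infinity>"
  proof -
    have "(2::real) powr (DIM('a) - a) < 2 powr 0"
      using assms by (subst powr_less_cancel_iff) auto
    then have "summable (\<lambda>k. r powr (- a) * (?v * (2 * r) ^ DIM('a)) * (2 powr (DIM('a) - a)) ^ k)"
      by (intro summable_mult summable_geometric) auto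
    then show ?thesis
      unfolding infinity_ennreal_def less_top[symmetric]
      by (rule ennreal_suminf_neq_top) (use \<open>r > 0\<close> in simp)
  qed
  finally show "(\<integral>\<^sup>+x. ennreal (norm (?f x)) \<partial>lborel) < \<infinity>" .
qed

text \<open>The range of \<open>t\<close> is dictated by the application, where \<open>1 + t\<close>
  is the squared ratio of \<open>norm (x - y)\<close> to \<open>norm x\<close> and
  \<open>norm y\<close> is at most half of \<open>norm x\<close>; hence
  \<open>1 + t \<ge> 1/4\<close> and \<open>\<bar>t\<bar> \<le> 5/4\<close>. Staying away from
  \<open>-1\<close> bounds the second derivative.\<close>

lemma powr_one_plus_taylor:
  fixes s :: real
  assumes "s > 0"
  obtains C where "C \<ge> 0" "\<And>t. \<bar>t\<bar> \<le> 5/4 \<Longrightarrow> t \<ge> -3/4 \<Longrightarrow> \<bar>(1 + t) powr (- s / 2) - 1 + s / 2 * t\<bar> \<le> C * t\<^sup>2"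
proof
  \<comment> \<open>Half of the second derivative at \<open>-3/4\<close>, where it is largest
    because the exponent is negative.\<close>
  define C where "C = (s / 2) * (s / 2 + 1) * (1/4) powr (- s / 2 - 2) / 2"
  show "C \<ge> 0"
    using assms by (simp add: C_def)
  fix t :: real assume t: "\<bar>t\<bar> \<le> 5/4" "t \<ge> -3/4"
  show "\<bar>(1 + t) powr (- s / 2) - 1 + s / 2 * t\<bar> \<le> C * t\<^sup>2"
  proof (cases "t = 0")
    case False
    \<comment> \<open>The expansion uses orders 0 to 2 only; the last branch is the derivative of
      its order just for \<open>m = 2\<close>.\<close>
    define diff where "diff = (\<lambda>m::nat. \<lambda>t::real.
      if m = 0 then (1 + t) powr (- s / 2) else if m = 1 then (- s / 2) * (1 + t) powr (- s / 2 - 1)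
      else (s / 2) * (s / 2 + 1) * (1 + t) powr (- s / 2 - 2))"
    have "\<exists>\<xi>. (if t < 0 then t < \<xi> \<and> \<xi> < 0 else 0 < \<xi> \<and> \<xi> < t) \<and>
      (1 + t) powr (- s / 2) = (\<Sum>m<2. diff m 0 / fact m * (t - 0) ^ m) + diff 2 \<xi> / fact 2 * (t - 0) ^ 2"
    proof (rule Taylor[where a = "-3/4" and b = "5/4"])
      show "diff 0 = (\<lambda>t. (1 + t) powr (- s / 2))"
        by (auto simp: diff_def)
      show "\<forall>m \<tau>. m < 2 \<and> - 3 / 4 \<le> \<tau> \<and> \<tau> \<le> 5 / 4 \<longrightarrow>
        (diff m has_real_derivative diff (Suc m) \<tau>) (at \<tau>)"
      proof (intro allI impI)
        fix m :: nat and \<tau> :: real assume m: "m < 2 \<and> - 3 / 4 \<le> \<tau> \<and> \<tau> \<le> 5 / 4"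
        then consider "m = 0" | "m = 1" by linarith
        then show "(diff m has_real_derivative diff (Suc m) \<tau>) (at \<tau>)"
          using m unfolding diff_def
          by cases (auto intro!: derivative_eq_intros simp: field_simps)
      qed
    qed (use t False in auto)
    then obtain \<xi> where \<xi>0: "if t < 0 then t < \<xi> \<and> \<xi> < 0 else 0 < \<xi> \<and> \<xi> < t" and
      eq: "(1 + t) powr (- s / 2) = (\<Sum>m<2. diff m 0 / fact m * (t - 0) ^ m) + diff 2 \<xi> / fact 2 * (t - 0) ^ 2"
      by blast
    from \<xi>0 have \<xi>: "\<xi> \<ge> -3/4"
      using t by (auto split: if_splits)
    have "(1 + \<xi>) powr (- s / 2 - 2) \<le> (1/4) powr (- s / 2 - 2)"
      using \<xi> assms by (intro powr_mono2') auto
    then have "diff 2 \<xi> / 2 \<le> C"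
      using assms by (auto simp: diff_def C_def intro!: mult_left_mono)
    moreover have "diff 2 \<xi> \<ge> 0"
      using assms by (simp add: diff_def)
    moreover have "(1 + t) powr (- s / 2) - 1 + s / 2 * t = diff 2 \<xi> / 2 * t\<^sup>2"
      unfolding eq by (simp add: numeral_2_eq_2 diff_def)
    ultimately have "\<bar>(1 + t) powr (- s / 2) - 1 + s / 2 * t\<bar> = diff 2 \<xi> / 2 * t\<^sup>2"
      by (simp only: abs_mult abs_power2)
    also have "\<dots> \<le> C * t\<^sup>2"
      by (intro mult_right_mono \<open>diff 2 \<xi> / 2 \<le> C\<close>) auto
    finally show ?thesis .
  qed auto
qed

section \<open>The Riesz kernel and its second differences\<close>

lemma riesz_nonneg [simp]: "riesz s x \<ge> 0"
  by (simp add: riesz_def)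

lemma riesz_minus [simp]: "riesz s (- x) = riesz s x"
  by (simp add: riesz_def)

lemma borel_measurable_riesz [measurable]: "riesz s \<in> borel_measurable borel"
  unfolding riesz_def[abs_def] powr_def by measurable

lemma riesz_scale: "c > 0 \<Longrightarrow> riesz s (c *\<^sub>R x) = c powr (- s) * riesz s x"
  by (simp add: riesz_def powr_mult)

text \<open>With \<open>t\<close> the relative change of the squared norm, the kernel is
  \<open>norm x powr (- s) * (1 + t) powr (- s / 2)\<close>. The part of \<open>- s / 2 * t\<close>
  linear in \<open>y\<close> is the dipole term; everything else is of second order in
  \<open>norm y / norm x\<close>.\<close>

lemma riesz_taylor:
  fixes B s :: real
  assumes "s > 0" "B > 0"
  obtains C where "C \<ge> 0"
    "\<And>x y :: real ^ 'n::finite. norm y \<le> B \<Longrightarrow> norm x \<ge> 2 * B \<Longrightarrow>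
      \<bar>riesz s (x - y) - riesz s x - s * (x \<bullet> y) * norm x powr (- s - 2)\<bar> \<le> C * norm x powr (- s - 2)"
proof -
  obtain C0 where C0: "C0 \<ge> 0"
    "\<And>t. \<bar>t\<bar> \<le> 5/4 \<Longrightarrow> t \<ge> -3/4 \<Longrightarrow> \<bar>(1 + t) powr (- s / 2) - 1 + s / 2 * t\<bar> \<le> C0 * t\<^sup>2"
    using powr_one_plus_taylor[OF assms(1)] by blast
  \<comment> \<open>The first summand comes from
    \<open>\<bar>t\<bar> \<le> 5/2 * B / norm x\<close>, the second from the contribution of the
    squared norm of \<open>y\<close> to \<open>s / 2 * t\<close>.\<close>
  define C where "C = C0 * (5/2 * B)\<^sup>2 + s / 2 * B\<^sup>2"
  show ?thesis
  proof
    show "C \<ge> 0" using C0 assms by (simp add: C_def)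
    fix x y :: "real ^ 'n" assume y: "norm y \<le> B" and x: "norm x \<ge> 2 * B"
    define n where "n = norm x"
    have n: "n > 0" "B \<le> n / 2" "norm y \<le> n / 2"
      using x y assms by (auto simp: n_def)
    define t where "t = (- 2 * (x \<bullet> y) + (norm y)\<^sup>2) / n\<^sup>2"
    have xy: "(norm (x - y))\<^sup>2 = n\<^sup>2 * (1 + t)"
      using n by (simp add: t_def field_simps n_def power2_norm_eq_inner inner_diff_left inner_diff_right inner_commute)
    have "\<bar>x \<bullet> y\<bar> \<le> n * norm y"
      unfolding n_def by (rule Cauchy_Schwarz_ineq2)
    then have "\<bar>- 2 * (x \<bullet> y) + (norm y)\<^sup>2\<bar> \<le> 2 * (n * norm y) + (norm y)\<^sup>2"
      using zero_le_power2[of "norm y"] by linarith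
    moreover have "(norm y)\<^sup>2 \<le> norm y * (n / 2)"
      unfolding power2_eq_square using n by (intro mult_left_mono) auto
    ultimately have num: "\<bar>- 2 * (x \<bullet> y) + (norm y)\<^sup>2\<bar> \<le> 5/2 * (norm y * n)"
      by (simp only: mult.commute[of n] times_divide_eq_right[symmetric])
    have t1: "\<bar>t\<bar> \<le> 5/2 * norm y / n"
      using num n by (simp add: t_def abs_div field_simps power2_eq_square)
    also have "\<dots> \<le> 5/2 * (n / 2) / n"
      using n by (intro divide_right_mono mult_left_mono) auto
    finally have t2: "\<bar>t\<bar> \<le> 5/4"
      using n by simp
    have "n / 2 \<le> norm (x - y)"
      using norm_triangle_ineq2[of x y] n by (simp add: n_def)
    then have "(n / 2)\<^sup>2 \<le> n\<^sup>2 * (1 + t)"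
      unfolding xy[symmetric] using n by (intro power_mono) auto
    then have "n\<^sup>2 * (1 / 4) \<le> n\<^sup>2 * (1 + t)"
      by (simp add: power_divide)
    then have t3: "t \<ge> -3/4"
      using n by (subst (asm) mult_le_cancel_left_pos) auto
    have r1: "riesz s (x - y) = n powr (- s) * (1 + t) powr (- s / 2)"
    proof -
      have "norm (x - y) = sqrt (n\<^sup>2 * (1 + t))"
        using xy by (metis norm_ge_zero real_sqrt_abs abs_of_nonneg)
      also have "\<dots> = n * sqrt (1 + t)"
        using n by (simp add: real_sqrt_mult)
      finally show ?thesis
        using n t3 by (simp add: riesz_def powr_mult powr_half_sqrt[symmetric] powr_powr)
    qed
    have n2: "n powr (- s - 2) = n powr (- s) / n\<^sup>2"
      using n by (simp add: powr_diff)
    have "riesz s (x - y) - riesz s x - s * (x \<bullet> y) * norm x powr (- s - 2)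
        = n powr (- s) * ((1 + t) powr (- s / 2) - 1 - s * (x \<bullet> y) / n\<^sup>2)"
      unfolding r1 n_def[symmetric] n2 by (simp add: riesz_def n_def[symmetric] algebra_simps)
    also have "(1 + t) powr (- s / 2) - 1 - s * (x \<bullet> y) / n\<^sup>2
        = ((1 + t) powr (- s / 2) - 1 + s / 2 * t) - s / 2 * (norm y)\<^sup>2 / n\<^sup>2"
      using n by (simp add: t_def field_simps)
    finally have "\<bar>riesz s (x - y) - riesz s x - s * (x \<bullet> y) * norm x powr (- s - 2)\<bar>
        = n powr (- s) * \<bar>((1 + t) powr (- s / 2) - 1 + s / 2 * t) - s / 2 * (norm y)\<^sup>2 / n\<^sup>2\<bar>"
      by (simp add: abs_mult)
    also have "\<dots> \<le> n powr (- s) * (C / n\<^sup>2)"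
    proof (rule mult_left_mono)
      have "\<bar>t\<bar> \<le> 5/2 * B / n"
        using t1 y n by (meson divide_right_mono mult_left_mono order_trans less_imp_le zero_le_divide_iff zero_le_numeral)
      then have "t\<^sup>2 \<le> (5/2 * B / n)\<^sup>2"
        by (metis abs_ge_zero power2_abs power_mono)
      then have 1: "C0 * t\<^sup>2 \<le> C0 * ((5/2 * B)\<^sup>2 / n\<^sup>2)"
        using C0(1) by (intro mult_left_mono) (auto simp: power_divide)
      have "(norm y)\<^sup>2 \<le> B\<^sup>2"
        using y by (intro power_mono) auto
      then have 2: "s / 2 * (norm y)\<^sup>2 / n\<^sup>2 \<le> s / 2 * B\<^sup>2 / n\<^sup>2"
        using assms by (intro divide_right_mono mult_left_mono) auto
      have 3: "0 \<le> s / 2 * (norm y)\<^sup>2 / n\<^sup>2"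
        using assms by auto
      have "C / n\<^sup>2 = C0 * ((5/2 * B)\<^sup>2 / n\<^sup>2) + s / 2 * B\<^sup>2 / n\<^sup>2"
        by (simp add: C_def add_divide_distrib)
      then show "\<bar>((1 + t) powr (- s / 2) - 1 + s / 2 * t) - s / 2 * (norm y)\<^sup>2 / n\<^sup>2\<bar> \<le> C / n\<^sup>2"
        using C0(2)[OF t2 t3] 1 2 3 by linarith
    qed auto
    also have "\<dots> = C * norm x powr (- s - 2)"
      unfolding n_def[symmetric] n2 by simp
    finally show "\<bar>riesz s (x - y) - riesz s x - s * (x \<bullet> y) * norm x powr (- s - 2)\<bar> \<le> C * norm x powr (- s - 2)" .
  qed
qed

text \<open>The subtracted part is affine in \<open>y\<close>, so that it disappears from neutral, dipole-free
  superpositions of kernels and from symmetric second differences.\<close>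

definition reduced_kernel :: "real \<Rightarrow> real \<Rightarrow> real ^ 'n::finite \<Rightarrow> real ^ 'n \<Rightarrow> real" where
  "reduced_kernel s B x y = riesz s (x - y) -
    (if norm x \<ge> 2 * B then riesz s x + s * (x \<bullet> y) * norm x powr (- s - 2) else 0)"

lemma borel_measurable_reduced_kernel [measurable (raw)]:
  assumes [measurable]: "f \<in> borel_measurable M" "g \<in> borel_measurable M"
  shows "(\<lambda>z. reduced_kernel s B (f z) (g z)) \<in> borel_measurable M"
  unfolding reduced_kernel_def powr_def by measurable

text \<open>Inside the ball of radius \<open>2 * B\<close> the point \<open>x - y\<close> stays in
  the ball of radius \<open>3 * B\<close>, where the singularity is integrable for
  \<open>s < d\<close>; outside, the remainder has exponent \<open>s + 2 > d\<close>. The first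
  bound is a translate of a fixed function, which makes \<open>C\<close> uniform in
  \<open>y\<close>, as Fubini will require.\<close>

lemma reduced_kernel_integrable:
  fixes s B :: real
  assumes "0 < s" "real CARD('n::finite) - 2 < s" "s < real CARD('n)" "B > 0"
  obtains C where "C \<ge> 0" "\<And>y :: real ^ 'n. norm y \<le> B \<Longrightarrow> integrable lborel (\<lambda>x. reduced_kernel s B x y)"
    "\<And>y :: real ^ 'n. norm y \<le> B \<Longrightarrow> (\<integral>x. \<bar>reduced_kernel s B x y\<bar> \<partial>lborel) \<le> C"
proof -
  obtain C1 where C1: "C1 \<ge> 0"
    "\<And>x y :: real ^ 'n::finite. norm y \<le> B \<Longrightarrow> norm x \<ge> 2 * B \<Longrightarrow>
      \<bar>riesz s (x - y) - riesz s x - s * (x \<bullet> y) * norm x powr (- s - 2)\<bar> \<le> C1 * norm x powr (- s - 2)"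
    using riesz_taylor[OF assms(1,4)] by blast
  let ?n = "\<lambda>x::real^'n. indicator (ball 0 (3 * B)) x * norm x powr (- s)"
  let ?f = "\<lambda>x::real^'n. indicator (- ball 0 (2 * B)) x * norm x powr (- (s + 2))"
  have n: "integrable lborel ?n"
    using assms by (intro powr_norm_integrable_near) auto
  have f: "integrable lborel ?f"
    using assms by (intro powr_norm_integrable_far) auto
  have ny: "integrable lborel (\<lambda>x. ?n (x - y))" "(\<integral>x. ?n (x - y) \<partial>lborel) = (\<integral>x. ?n x \<partial>lborel)" for y
  proof -
    show "integrable lborel (\<lambda>x. ?n (x - y))"
      using lborel_integrable_affine[OF n, of 1 "- y"] by simp
    have [measurable]: "?n \<in> borel_measurable borel"
      using n by auto
    show "(\<integral>x. ?n (x - y) \<partial>lborel) = (\<integral>x. ?n x \<partial>lborel)"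
      using lborel_integral_affine[of ?n 1 "- y"] by simp
  qed
  have bound: "\<bar>reduced_kernel s B x y\<bar> \<le> ?n (x - y) + C1 * ?f x" if "norm y \<le> B" for x y :: "real ^ 'n"
  proof (cases "norm x \<ge> 2 * B")
    case True
    then have "\<bar>reduced_kernel s B x y\<bar> \<le> C1 * norm x powr (- s - 2)"
      using C1(2)[OF that True] by (simp only: reduced_kernel_def if_True diff_diff_eq)
    also have "\<dots> = C1 * ?f x"
      using True by simp
    also have "\<dots> \<le> ?n (x - y) + C1 * ?f x"
      by simp
    finally show ?thesis .
  next
    case False
    have "norm (x - y) < 3 * B"
      using False that norm_triangle_ineq4[of x y] by simp
    then show ?thesis
      using False by (simp add: reduced_kernel_def riesz_def)
  qed
  have int: "integrable lborel (\<lambda>x. ?n (x - y) + C1 * ?f x)" for y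
    by (intro Bochner_Integration.integrable_add ny integrable_mult_right f)
  show ?thesis
  proof
    show "0 \<le> (\<integral>x. ?n x \<partial>lborel) + C1 * (\<integral>x. ?f x \<partial>lborel)"
      using C1(1) by (intro add_nonneg_nonneg mult_nonneg_nonneg Bochner_Integration.integral_nonneg) auto
    fix y :: "real ^ 'n" assume y: "norm y \<le> B"
    show *: "integrable lborel (\<lambda>x. reduced_kernel s B x y)"
      by (rule Bochner_Integration.integrable_bound[OF int[of y]]) (use bound[OF y] in \<open>auto intro!: AE_I2 order_trans[OF _ abs_ge_self]\<close>)
    have "(\<integral>x. \<bar>reduced_kernel s B x y\<bar> \<partial>lborel) \<le> (\<integral>x. ?n (x - y) + C1 * ?f x \<partial>lborel)"
      by (intro integral_mono integrable_abs * int bound y)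
    also have "\<dots> = (\<integral>x. ?n x \<partial>lborel) + C1 * (\<integral>x. ?f x \<partial>lborel)"
      by (subst Bochner_Integration.integral_add) (use ny f in \<open>auto intro!: integrable_mult_right\<close>)
    finally show "(\<integral>x. \<bar>reduced_kernel s B x y\<bar> \<partial>lborel) \<le> (\<integral>x. ?n x \<partial>lborel) + C1 * (\<integral>x. ?f x \<partial>lborel)" .
  qed
qed

section \<open>Symmetric second differences of the kernel\<close>

definition second_difference :: "real \<Rightarrow> real ^ 'n::finite \<Rightarrow> real ^ 'n \<Rightarrow> real" where
  "second_difference s y x = riesz s (x + y) + riesz s (x - y) - 2 * riesz s x"

lemma borel_measurable_second_difference [measurable]:
  "second_difference s y \<in> borel_measurable borel"
  unfolding second_difference_def by measurable

lemma second_difference_eq_reduced_kernel: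
  "second_difference s y x =
    reduced_kernel s B x (- y) + reduced_kernel s B x y - 2 * reduced_kernel s B x 0"
  by (simp add: second_difference_def reduced_kernel_def algebra_simps)

text \<open>With \<open>S\<close> the translation by \<open>y\<close>, this is the factorisation
  \<open>S^2 + S^-2 - 2 = (S + S^-1 - 2) (S + S^-1 + 2)\<close>. The coefficients of the second
  factor add up to 4, the source of the factor 4 after integration.\<close>

lemma second_difference_double:
  "second_difference s (2 *\<^sub>R y) x =
    second_difference s y (x + y) + second_difference s y (x - y) + 2 * second_difference s y x"
  by (simp add: second_difference_def algebra_simps scaleR_2)

lemma second_difference_scale:
  assumes "c > 0"
  shows "second_difference s (c *\<^sub>R y) (c *\<^sub>R x) = c powr (- s) * second_difference s y x"
  using assms
  by (simp add: second_difference_def riesz_scale algebra_simps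
    flip: scaleR_add_right scaleR_diff_right)

lemma second_difference_integrable:
  fixes s B :: real
  assumes "0 < s" "real CARD('n::finite) - 2 < s" "s < real CARD('n)"
  obtains C where "\<And>y :: real ^ 'n. norm y \<le> B \<Longrightarrow> (\<integral>x. \<bar>second_difference s y x\<bar> \<partial>lborel) \<le> C"
    "\<And>y :: real ^ 'n. norm y \<le> B \<Longrightarrow> integrable lborel (second_difference s y)"
proof -
  \<comment> \<open>The reduced kernel is controlled for a positive radius, while \<open>B\<close>
    is arbitrary here.\<close>
  define B' where "B' = max B 1"
  have B': "B' > 0" "B \<le> B'"
    by (auto simp: B'_def)
  obtain C where C: "C \<ge> 0" and int: "\<And>y :: real ^ 'n. norm y \<le> B' \<Longrightarrow> integrable lborel (\<lambda>x. reduced_kernel s B' x y)"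
    and le: "\<And>y :: real ^ 'n. norm y \<le> B' \<Longrightarrow> (\<integral>x. \<bar>reduced_kernel s B' x y\<bar> \<partial>lborel) \<le> C"
    using reduced_kernel_integrable[OF assms B'(1)] by blast
  have int': "integrable lborel (second_difference s y)" if "norm y \<le> B" for y :: "real ^ 'n"
    unfolding second_difference_eq_reduced_kernel[where B = B', abs_def] using that B'
    by (intro Bochner_Integration.integrable_add Bochner_Integration.integrable_diff
        integrable_mult_right int) auto
  show ?thesis
  proof
    fix y :: "real ^ 'n" assume y: "norm y \<le> B"
    show "integrable lborel (second_difference s y)"
      using y by (rule int')
    have "(\<integral>x. \<bar>second_difference s y x\<bar> \<partial>lborel) \<le>
        (\<integral>x. \<bar>reduced_kernel s B' x (- y)\<bar> + \<bar>reduced_kernel s B' x y\<bar> + 2 * \<bar>reduced_kernel s B' x 0\<bar> \<partial>lborel)"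
      using y B' by (intro integral_mono integrable_abs int' Bochner_Integration.integrable_add integrable_mult_right int)
        (auto simp: second_difference_eq_reduced_kernel[of _ _ _ B'])
    also have "\<dots> = (\<integral>x. \<bar>reduced_kernel s B' x (- y)\<bar> \<partial>lborel) + (\<integral>x. \<bar>reduced_kernel s B' x y\<bar> \<partial>lborel)
        + 2 * (\<integral>x. \<bar>reduced_kernel s B' x (0 :: real ^ 'n)\<bar> \<partial>lborel)"
      using y B' by (simp add: int integrable_abs)
    also have "\<dots> \<le> C + C + 2 * C"
      using y B' by (intro add_mono mult_left_mono le) auto
    finally show "(\<integral>x. \<bar>second_difference s y x\<bar> \<partial>lborel) \<le> C + C + 2 * C" .
  qed
qed

lemma second_difference_integral_eq_0:
  fixes s :: real and y :: "real ^ 'n::finite"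
  assumes "0 < s" "real CARD('n) - 2 < s" "s < real CARD('n)"
  shows "(\<integral>x. second_difference s y x \<partial>lborel) = 0"
proof -
  let ?I = "\<lambda>y::real^'n. \<integral>x. second_difference s y x \<partial>lborel"
  have int: "integrable lborel (second_difference s y)"
    using second_difference_integrable[OF assms, where B = "norm y"] by blast
  have shift: "integrable lborel (\<lambda>x. second_difference s y (x + v))"
    "(\<integral>x. second_difference s y (x + v) \<partial>lborel) = ?I y" for v
    using lborel_integrable_affine[OF int, of 1 v] lborel_integral_affine[of "second_difference s y" 1 v]
    by (simp_all add: add.commute)
  have "?I (2 *\<^sub>R y) = 4 * ?I y"
    unfolding second_difference_double using shift[of y] shift[of "- y"] int by simp
  moreover have "?I (2 *\<^sub>R y) = 2 ^ CARD('n) * (2 powr (- s) * ?I y)"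
    using lborel_integral_affine[of "second_difference s (2 *\<^sub>R y)" 2 0]
    by (simp add: second_difference_scale)
  moreover have "2 ^ CARD('n) * (2::real) powr (- s) = 2 powr (CARD('n) - s)"
    by (simp add: powr_diff powr_realpow powr_minus divide_inverse)
  moreover have "(2::real) powr (CARD('n) - s) < 2 powr 2"
    using assms by (subst powr_less_cancel_iff) auto
  ultimately have "4 * ?I y = 2 powr (CARD('n) - s) * ?I y" "(2::real) powr (CARD('n) - s) < 4"
    by (simp_all flip: mult.assoc)
  then show ?thesis
    by auto
qed

text \<open>Reflecting \<open>x\<close> shows the integral to be even in \<open>y\<close>; the
  vanishing integral of the second difference then equates twice its value at \<open>y\<close> with
  twice its value at 0. Independence of \<open>y\<close> turns integration against a measure into
  multiplication by its mass.\<close>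

lemma reduced_kernel_integral_const:
  fixes s B :: real and y :: "real ^ 'n::finite"
  assumes "0 < s" "real CARD('n) - 2 < s" "s < real CARD('n)" "B > 0" "norm y \<le> B"
  shows "(\<integral>x. reduced_kernel s B x y \<partial>lborel) = (\<integral>x. reduced_kernel s B x (0 :: real ^ 'n) \<partial>lborel)"
proof -
  have int: "integrable lborel (\<lambda>x. reduced_kernel s B x y)" if "norm y \<le> B" for y :: "real ^ 'n"
    using reduced_kernel_integrable[OF assms(1-4)] that by metis
  have "(\<integral>x. reduced_kernel s B x (- y) \<partial>lborel) = (\<integral>x. reduced_kernel s B (- x) (- y) \<partial>lborel)"
    using lborel_integral_affine[of "\<lambda>x. reduced_kernel s B x (- y)" "-1" 0] by simp
  also have "\<dots> = (\<integral>x. reduced_kernel s B x y \<partial>lborel)"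
  proof (intro Bochner_Integration.integral_cong refl)
    fix x :: "real ^ 'n"
    have "riesz s (- x - - y) = riesz s (x - y)"
      using riesz_minus[of s "x - y"] by simp
    then show "reduced_kernel s B (- x) (- y) = reduced_kernel s B x y"
      by (simp add: reduced_kernel_def)
  qed
  finally have even: "(\<integral>x. reduced_kernel s B x (- y) \<partial>lborel) = (\<integral>x. reduced_kernel s B x y \<partial>lborel)" .
  have "(\<integral>x. second_difference s y x \<partial>lborel) = (\<integral>x. reduced_kernel s B x (- y) \<partial>lborel)
      + (\<integral>x. reduced_kernel s B x y \<partial>lborel) - 2 * (\<integral>x. reduced_kernel s B x (0 :: real ^ 'n) \<partial>lborel)"
    unfolding second_difference_eq_reduced_kernel[of _ _ _ B]
    using assms int[of y] int[of "- y"] int[of 0] by simp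
  then show ?thesis
    using second_difference_integral_eq_0[OF assms(1-3), of y] even by simp
qed

text \<open>Fubini is applied to the reduced kernel, which is integrable in \<open>x\<close>, unlike
  \<open>riesz\<close> itself. The last claim translates back to the actual potential, and the
  correction it pays depends on \<open>M\<close> only through mass and first moment.\<close>

lemma reduced_kernel_potential:
  fixes s B :: real and M :: "(real ^ 'n::finite) measure"
  assumes s: "0 < s" "real CARD('n) - 2 < s" "s < real CARD('n)" and B: "B > 0"
    and M: "finite_measure M" "sets M = sets borel" "AE y in M. norm y \<le> B"
  shows "integrable lborel (\<lambda>x. \<integral>y. reduced_kernel s B x y \<partial>M)"
    and "(\<integral>x. (\<integral>y. reduced_kernel s B x y \<partial>M) \<partial>lborel) = measure M UNIV * (\<integral>x. reduced_kernel s B x (0 :: real ^ 'n) \<partial>lborel)"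
    and "AE x in lborel. (\<integral>y. reduced_kernel s B x y \<partial>M) = (\<integral>y. riesz s (x - y) \<partial>M) -
      (if norm x \<ge> 2 * B then riesz s x * measure M UNIV + s * (x \<bullet> (\<integral>y. y \<partial>M)) * norm x powr (- s - 2) else 0)"
proof -
  interpret M: finite_measure M by fact
  interpret pair_sigma_finite lborel M ..
  note [measurable_cong] = M(2)
  have space_M: "space M = UNIV"
    using sets_eq_imp_space_eq[OF M(2)] by simp
  let ?k = "\<lambda>(x, y). reduced_kernel s B x y"
  obtain C where C: "C \<ge> 0" and int: "\<And>y :: real ^ 'n. norm y \<le> B \<Longrightarrow> integrable lborel (\<lambda>x. reduced_kernel s B x y)"
    and le: "\<And>y :: real ^ 'n. norm y \<le> B \<Longrightarrow> (\<integral>x. \<bar>reduced_kernel s B x y\<bar> \<partial>lborel) \<le> C"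
    using reduced_kernel_integrable[OF s B] by blast
  have meas [measurable]: "?k \<in> borel_measurable (lborel \<Otimes>\<^sub>M M)"
    by measurable
  have k: "integrable (lborel \<Otimes>\<^sub>M M) ?k"
  proof (rule integrableI_bounded)
    have "(\<integral>\<^sup>+z. ennreal (norm (?k z)) \<partial>(lborel \<Otimes>\<^sub>M M)) = (\<integral>\<^sup>+y. \<integral>\<^sup>+x. ennreal \<bar>reduced_kernel s B x y\<bar> \<partial>lborel \<partial>M)"
      by (subst nn_integral_snd[symmetric]) (simp_all add: split_beta)
    also have "\<dots> \<le> (\<integral>\<^sup>+y. ennreal C \<partial>M)"
    proof (rule nn_integral_mono_AE)
      show "AE y in M. (\<integral>\<^sup>+x. ennreal \<bar>reduced_kernel s B x y\<bar> \<partial>lborel) \<le> ennreal C"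
        using M(3)
      proof eventually_elim
        fix y :: "real ^ 'n" assume y: "norm y \<le> B"
        have "(\<integral>\<^sup>+x. ennreal \<bar>reduced_kernel s B x y\<bar> \<partial>lborel) = ennreal (\<integral>x. \<bar>reduced_kernel s B x y\<bar> \<partial>lborel)"
          by (rule nn_integral_eq_integral) (use int[OF y] in auto)
        then show "(\<integral>\<^sup>+x. ennreal \<bar>reduced_kernel s B x y\<bar> \<partial>lborel) \<le> ennreal C"
          using le[OF y] by (simp add: ennreal_leI)
      qed
    qed
    also have "\<dots> < \<infinity>"
      using M.emeasure_finite by (simp add: ennreal_mult_less_top less_top[symmetric] ennreal_mult_eq_top_iff)
    finally show "(\<integral>\<^sup>+z. ennreal (norm (?k z)) \<partial>(lborel \<Otimes>\<^sub>M M)) < \<infinity>" .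
  qed fact
  show "integrable lborel (\<lambda>x. \<integral>y. reduced_kernel s B x y \<partial>M)"
    using integrable_fst'[OF k] by simp
  have "(\<integral>x. (\<integral>y. reduced_kernel s B x y \<partial>M) \<partial>lborel) = (\<integral>y. (\<integral>x. reduced_kernel s B x y \<partial>lborel) \<partial>M)"
    using Fubini_integral[of "reduced_kernel s B"] k by simp
  also have "\<dots> = (\<integral>y. (\<integral>x. reduced_kernel s B x (0::real^'n) \<partial>lborel) \<partial>M)"
  proof (rule integral_cong_AE)
    show "AE y in M. (\<integral>x. reduced_kernel s B x y \<partial>lborel) = (\<integral>x. reduced_kernel s B x (0::real^'n) \<partial>lborel)"
      using M(3) by eventually_elim (rule reduced_kernel_integral_const[OF s B])
  qed measurable
  also have "\<dots> = measure M UNIV * (\<integral>x. reduced_kernel s B x (0::real^'n) \<partial>lborel)"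
    by (simp add: space_M)
  finally show "(\<integral>x. (\<integral>y. reduced_kernel s B x y \<partial>M) \<partial>lborel) = measure M UNIV * (\<integral>x. reduced_kernel s B x (0 :: real ^ 'n) \<partial>lborel)" .
  have y: "integrable M (\<lambda>y. y)"
    by (rule M.integrable_const_bound[where B = B]) (use M(3) in auto)
  \<comment> \<open>Splitting the kernel under the integral is sound only where it is integrable in
    \<open>y\<close>, since a nonintegrable function would receive the value 0. Fubini provides this
    for almost every \<open>x\<close>.\<close>
  have "AE x in lborel. integrable M (\<lambda>y. reduced_kernel s B x y)"
    using AE_integrable_fst'[OF k] by simp
  then show "AE x in lborel. (\<integral>y. reduced_kernel s B x y \<partial>M) = (\<integral>y. riesz s (x - y) \<partial>M) -
      (if norm x \<ge> 2 * B then riesz s x * measure M UNIV + s * (x \<bullet> (\<integral>y. y \<partial>M)) * norm x powr (- s - 2) else 0)"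
  proof eventually_elim
    fix x :: "real ^ 'n" assume kx: "integrable M (\<lambda>y. reduced_kernel s B x y)"
    define q where "q y = (if norm x \<ge> 2 * B then riesz s x + s * (x \<bullet> y) * norm x powr (- s - 2) else 0)" for y :: "real ^ 'n"
    have q: "integrable M q"
      unfolding q_def using y
      by (cases "norm x \<ge> 2 * B") (auto intro!: Bochner_Integration.integrable_add integrable_mult_left integrable_mult_right)
    have qi: "(\<integral>y. q y \<partial>M) = (if norm x \<ge> 2 * B then riesz s x * measure M UNIV + s * (x \<bullet> (\<integral>y. y \<partial>M)) * norm x powr (- s - 2) else 0)"
      unfolding q_def using y
      by (cases "norm x \<ge> 2 * B") (auto simp: space_M)
    have r: "riesz s (x - y) = reduced_kernel s B x y + q y" for y
      by (simp add: reduced_kernel_def q_def)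
    show "(\<integral>y. reduced_kernel s B x y \<partial>M) = (\<integral>y. riesz s (x - y) \<partial>M) -
      (if norm x \<ge> 2 * B then riesz s x * measure M UNIV + s * (x \<bullet> (\<integral>y. y \<partial>M)) * norm x powr (- s - 2) else 0)"
      unfolding r qi[symmetric] using kx q by simp
  qed
qed

text \<open>Equal masses and first moments cancel the corrections of \<open>M\<close> and
  \<open>N\<close> almost everywhere, and the two reduced integrals are the same multiple of one
  constant. The common bound on the supports lets both measures share one reduced kernel.\<close>

lemma potential_neutral_dipole_free:
  fixes s B :: real and M N :: "(real ^ 'n::finite) measure"
  assumes s: "0 < s" "real CARD('n) - 2 < s" "s < real CARD('n)"
    and M: "finite_measure M" "sets M = sets borel" "AE y in M. norm y \<le> B"
    and N: "finite_measure N" "sets N = sets borel" "AE y in N. norm y \<le> B"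
    and neutral: "measure M UNIV = measure N UNIV" and dipole: "(\<integral>y. y \<partial>M) = (\<integral>y. y \<partial>N)"
  shows "integrable lborel (potential s (M, N))" and "(\<integral>x. potential s (M, N) x \<partial>lborel) = 0"
proof -
  interpret M: finite_measure M by fact
  interpret N: finite_measure N by fact
  note [measurable_cong] = M(2) N(2)
  define B' where "B' = max B 1"
  have B': "B' > 0"
    by (simp add: B'_def)
  have "AE y in M. norm y \<le> B'" "AE y in N. norm y \<le> B'"
    using M(3) N(3) by (auto simp: B'_def)
  note kM = reduced_kernel_potential[OF s B' M(1,2) this(1)]
    and kN = reduced_kernel_potential[OF s B' N(1,2) this(2)]
  let ?d = "\<lambda>x. (\<integral>y. reduced_kernel s B' x y \<partial>M) - (\<integral>y. reduced_kernel s B' x y \<partial>N)"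
  have [measurable]: "potential s (M, N) \<in> borel_measurable lborel"
    unfolding potential_def by simp
  have AE: "AE x in lborel. ?d x = potential s (M, N) x"
    using kM(3) kN(3) by eventually_elim (simp add: potential_def neutral dipole)
  have d: "integrable lborel ?d"
    by (intro Bochner_Integration.integrable_diff kM kN)
  show "integrable lborel (potential s (M, N))"
    by (rule integrable_cong_AE_imp[OF d]) (use AE in auto)
  have "(\<integral>x. potential s (M, N) x \<partial>lborel) = (\<integral>x. ?d x \<partial>lborel)"
    by (rule integral_cong_AE) (use AE d in auto)
  also have "\<dots> = (\<integral>x. (\<integral>y. reduced_kernel s B' x y \<partial>M) \<partial>lborel) - (\<integral>x. (\<integral>y. reduced_kernel s B' x y \<partial>N) \<partial>lborel)"
    by (intro Bochner_Integration.integral_diff kM kN)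
  also have "\<dots> = 0"
    unfolding kM(2) kN(2) neutral by simp
  finally show "(\<integral>x. potential s (M, N) x \<partial>lborel) = 0" .
qed

section \<open>Cubes and their cells\<close>

lemma norm_cube_le: "x \<in> cube R \<Longrightarrow> norm x \<le> real CARD('n) * (R / 2)" for x :: "real ^ 'n::finite"
proof -
  assume x: "x \<in> cube R"
  have "norm x \<le> (\<Sum>i\<in>UNIV. \<bar>x $ i\<bar>)"
    by (rule norm_le_l1_cart)
  also have "\<dots> \<le> (\<Sum>i\<in>(UNIV :: 'n set). R / 2)"
  proof (rule sum_mono)
    fix i
    have "- (R / 2) \<le> x $ i \<and> x $ i < R / 2"
      using x by (simp add: cube_def)
    then show "\<bar>x $ i\<bar> \<le> R / 2"
      by linarith
  qed
  finally show ?thesis by simp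
qed

text \<open>The half-open cube is not symmetric about 0, but up to a null set it is a closed box,
  which is. The volume and the reflection arguments rest on this comparison.\<close>

lemma AE_cube_eq_cbox:
  "AE x in lborel. x \<in> (cube R :: (real ^ 'n::finite) set) \<longleftrightarrow> x \<in> cbox (\<chi> i. - (R / 2)) (\<chi> i. R / 2)"
proof -
  let ?a = "(\<chi> i. - (R / 2)) :: real ^ 'n" and ?b = "(\<chi> i. R / 2) :: real ^ 'n"
  have "emeasure lborel (cbox ?a ?b - box ?a ?b) = 0"
    by (subst emeasure_Diff) (auto simp: emeasure_lborel_cbox_eq emeasure_lborel_box_eq box_subset_cbox)
  then have "AE x in lborel. x \<notin> cbox ?a ?b - box ?a ?b"
    by (intro AE_not_in) (auto simp: null_sets_def)
  then show ?thesis
  proof eventually_elim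
    fix x assume "x \<notin> cbox ?a ?b - box ?a ?b"
    moreover have "x \<in> cube R" if "x \<in> box ?a ?b"
      using that by (auto simp: cube_def mem_box_cart less_imp_le)
    moreover have "x \<in> cbox ?a ?b" if "x \<in> cube R"
      using that by (auto simp: cube_def mem_box_cart less_imp_le)
    ultimately show "x \<in> cube R \<longleftrightarrow> x \<in> cbox ?a ?b"
      by blast
  qed
qed

lemma emeasure_cube:
  assumes "R \<ge> 0"
  shows "emeasure lborel (cube R :: (real ^ 'n::finite) set) = ennreal (R ^ CARD('n))"
proof -
  let ?a = "(\<chi> i. - (R / 2)) :: real ^ 'n" and ?b = "(\<chi> i. R / 2) :: real ^ 'n"
  have "emeasure lborel (cube R :: (real ^ 'n) set) = emeasure lborel (cbox ?a ?b)"
    by (rule emeasure_eq_AE) (use AE_cube_eq_cbox in auto)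
  also have "\<dots> = ennreal (R ^ CARD('n))"
    using assms by (subst emeasure_lborel_cbox)
      (auto simp: Basis_vec_def inner_axis prod.UNION_disjoint axis_eq_axis card_UN_disjoint
        intro!: arg_cong[where f = ennreal] )
  finally show ?thesis .
qed

lemma measure_cube: "R \<ge> 0 \<Longrightarrow> measure lborel (cube R :: (real ^ 'n::finite) set) = R ^ CARD('n)"
  by (simp add: measure_def emeasure_cube)

lemma integrable_indicator_cube [simp]:
  "R \<ge> 0 \<Longrightarrow> integrable lborel (indicator (cube R :: (real ^ 'n::finite) set) :: _ \<Rightarrow> real)"
  by (rule integrable_real_indicator) (auto simp: emeasure_cube)

lemma AE_cube_uminus: "AE x in lborel. - x \<in> cube R \<longleftrightarrow> x \<in> (cube R :: (real ^ 'n::finite) set)"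
proof -
  let ?a = "(\<chi> i. - (R / 2)) :: real ^ 'n" and ?b = "(\<chi> i. R / 2) :: real ^ 'n"
  have "AE x in lborel. - x \<in> (cube R :: (real ^ 'n) set) \<longleftrightarrow> - x \<in> cbox ?a ?b"
  proof -
    have "lborel = distr lborel borel (uminus :: real ^ 'n \<Rightarrow> _)"
      using lborel_affine[of "- 1" "0 :: real ^ 'n"] by (simp add: density_1)
    then have "AE x in distr lborel borel uminus. x \<in> (cube R :: (real ^ 'n) set) \<longleftrightarrow> x \<in> cbox ?a ?b"
      using AE_cube_eq_cbox[of R, where 'n = 'n] by (rule subst)
    then show ?thesis
      by (subst (asm) AE_distr_iff) auto
  qed
  moreover have "- x \<in> cbox ?a ?b \<longleftrightarrow> x \<in> cbox ?a ?b" for x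
    by (auto simp: mem_box_cart minus_le_iff)
  ultimately show ?thesis
    using AE_cube_eq_cbox[of R, where 'n = 'n] by auto
qed

section \<open>Subdivision of a large cube into cells\<close>

definition cells :: "nat \<Rightarrow> ('n::finite \<Rightarrow> nat) set" where
  "cells k = {j. \<forall>i. j i < k}"

text \<open>The offset \<open>(real k - 1) / 2\<close> makes the set of centres symmetric about the
  origin. For odd \<open>k\<close> the centres are lattice points, for even \<open>k\<close> they
  are off the lattice by \<open>R1 / 2\<close> in every coordinate.\<close>

definition cell_center :: "real \<Rightarrow> nat \<Rightarrow> ('n::finite \<Rightarrow> nat) \<Rightarrow> real ^ 'n" where
  "cell_center R1 k j = (\<chi> i. R1 * (real (j i) - (real k - 1) / 2))"

lemma cells_eq_PiE: "cells k = PiE UNIV (\<lambda>_. {..<k})"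
  by (auto simp: cells_def PiE_def)

lemma finite_cells [simp]: "finite (cells k :: ('n::finite \<Rightarrow> nat) set)"
  by (simp add: cells_eq_PiE finite_PiE)

lemma card_cells [simp]: "card (cells k :: ('n::finite \<Rightarrow> nat) set) = k ^ CARD('n)"
  by (simp add: cells_eq_PiE card_PiE)

text \<open>After rescaling, each coordinate finds its cell index as a floor, so existence and
  uniqueness of the cell containing a point reduce to properties of \<open>floor\<close>.\<close>

lemma minus_cell_center_in_cube_iff:
  assumes "R1 > 0"
  shows "x - cell_center R1 k j \<in> cube R1 \<longleftrightarrow> (\<forall>i. \<lfloor>x $ i / R1 + real k / 2\<rfloor> = int (j i))"
proof -
  have "(- (R1 / 2) \<le> (x - cell_center R1 k j) $ i \<and> (x - cell_center R1 k j) $ i < R1 / 2)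
      \<longleftrightarrow> \<lfloor>x $ i / R1 + real k / 2\<rfloor> = int (j i)" for i
  proof -
    define w where "w = x $ i / R1"
    have c: "(x - cell_center R1 k j) $ i = R1 * (w - (real (j i) - (real k - 1) / 2))"
      using assms by (simp add: cell_center_def w_def right_diff_distrib)
    have "(- (R1 / 2) \<le> (x - cell_center R1 k j) $ i \<and> (x - cell_center R1 k j) $ i < R1 / 2) \<longleftrightarrow>
        R1 * (- (1 / 2)) \<le> R1 * (w - (real (j i) - (real k - 1) / 2)) \<and>
        R1 * (w - (real (j i) - (real k - 1) / 2)) < R1 * (1 / 2)"
      unfolding c by simp
    also have "\<dots> \<longleftrightarrow> - (1 / 2) \<le> w - (real (j i) - (real k - 1) / 2) \<and> w - (real (j i) - (real k - 1) / 2) < 1 / 2"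
      using assms by (simp only: mult_le_cancel_left_pos mult_less_cancel_left_pos)
    also have "\<dots> \<longleftrightarrow> \<lfloor>w + real k / 2\<rfloor> = int (j i)"
      unfolding floor_eq_iff of_int_of_nat_eq by (simp add: field_simps; argo)
    finally show ?thesis
      by (simp add: w_def)
  qed
  then show ?thesis
    by (simp add: cube_def)
qed

text \<open>Half-open cells tile the large cube exactly and not just up to a null set. The identity
  therefore serves integrals and sums over points of \<open>P\<close> alike, including points on
  cell boundaries.\<close>

lemma sum_indicator_cells:
  fixes x :: "real ^ 'n::finite"
  assumes "R1 > 0"
  shows "(\<Sum>j\<in>cells k. indicator (cube R1) (x - cell_center R1 k j)) = (indicator (cube (k * R1)) x :: real)"
proof -
  define f where "f i = \<lfloor>x $ i / R1 + real k / 2\<rfloor>" for i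
  have cell: "x - cell_center R1 k j \<in> cube R1 \<longleftrightarrow> (\<forall>i. f i = int (j i))" for j
    using minus_cell_center_in_cube_iff[OF assms] by (simp add: f_def)
  have cube: "x \<in> cube (k * R1) \<longleftrightarrow> (\<forall>i. 0 \<le> f i \<and> f i < int k)"
  proof -
    have "(- (real k * R1 / 2) \<le> x $ i \<and> x $ i < real k * R1 / 2) \<longleftrightarrow> 0 \<le> f i \<and> f i < int k" for i
      unfolding f_def floor_less_iff zero_le_floor using assms by (auto simp: field_simps)
    then show ?thesis
      unfolding cube_def by simp
  qed
  show ?thesis
  proof (cases "x \<in> cube (k * R1)")
    case True
    then have "x - cell_center R1 k j \<in> cube R1 \<longleftrightarrow> j = (\<lambda>i. nat (f i))" for j
      unfolding cell cube by (auto simp: fun_eq_iff)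
    moreover have "(\<lambda>i. nat (f i)) \<in> cells k"
      using True unfolding cube cells_def by (auto simp: nat_less_iff)
    ultimately show ?thesis
      using True by (simp add: indicator_def)
  next
    case False
    then have "x - cell_center R1 k j \<notin> cube R1" if "j \<in> cells k" for j
      using that unfolding cell cube cells_def by (metis (mono_tags, lifting) mem_Collect_eq of_nat_0_le_iff of_nat_less_iff)
    then show ?thesis
      using False by (simp add: indicator_def)
  qed
qed

lemma cell_center_reflect:
  "cell_center R1 k (\<lambda>i. k - 1 - j i) = - cell_center R1 k j" if "j \<in> cells k"
  unfolding vec_eq_iff
proof
  fix i
  have "j i < k" using that by (simp add: cells_def)
  then have "real (k - 1 - j i) = real k - 1 - real (j i)"
    by linarith
  then show "cell_center R1 k (\<lambda>i. k - 1 - j i) $ i = (- cell_center R1 k j) $ i"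
    unfolding cell_center_def by (simp add: field_simps)
qed

lemma sum_cells_reflect:
  fixes F :: "real ^ 'n::finite \<Rightarrow> 'a::comm_monoid_add"
  shows "(\<Sum>j\<in>cells k. F (- cell_center R1 k j)) = (\<Sum>j\<in>cells k. F (cell_center R1 k j))"
proof (rule sum.reindex_bij_witness[where i = "\<lambda>j i. k - 1 - j i" and j = "\<lambda>j i. k - 1 - j i"])
  fix j :: "'n \<Rightarrow> nat" assume j: "j \<in> cells k"
  then have k: "j i < k" for i
    by (simp add: cells_def)
  show "(\<lambda>i. k - 1 - (k - 1 - j i)) = j"
  proof
    fix i show "k - 1 - (k - 1 - j i) = j i"
      using k[of i] by linarith
  qed
  then show "(\<lambda>i. k - 1 - (k - 1 - j i)) = j" .
  show in_cells: "(\<lambda>i. k - 1 - j i) \<in> cells k"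
    unfolding cells_def
  proof safe
    fix i show "k - 1 - j i < k"
      using k[of i] by linarith
  qed
  then show "(\<lambda>i. k - 1 - j i) \<in> cells k" .
  show "F (cell_center R1 k (\<lambda>i. k - 1 - j i)) = F (- cell_center R1 k j)"
    by (simp only: cell_center_reflect[OF j])
qed

text \<open>Counts the centres that the displacement \<open>u\<close> keeps inside the large cube.
  Divided by \<open>k ^ d\<close> it is the weight in the overview, a discrete counterpart of the
  normalised overlap of the cube with its translate by \<open>u\<close>.\<close>

definition cell_count :: "real \<Rightarrow> nat \<Rightarrow> real ^ 'n::finite \<Rightarrow> real" where
  "cell_count R1 k u = (\<Sum>j\<in>cells k. indicator (cube (k * R1)) (u + cell_center R1 k j))"

lemma borel_measurable_cell_count [measurable]: "cell_count R1 k \<in> borel_measurable borel"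
  unfolding cell_count_def by measurable

lemma cell_count_nonneg: "cell_count R1 k u \<ge> 0"
  unfolding cell_count_def by (intro sum_nonneg) auto

lemma cell_count_le: "cell_count R1 k (u :: real ^ 'n::finite) \<le> real k ^ CARD('n)"
proof -
  have "cell_count R1 k u \<le> (\<Sum>j\<in>(cells k :: ('n \<Rightarrow> nat) set). 1)"
    unfolding cell_count_def by (intro sum_mono) (auto simp: indicator_def)
  then show ?thesis by simp
qed

text \<open>A displacement shorter than \<open>L\<close> cells can push out only centres within
  \<open>L\<close> layers of the boundary. For \<open>k \<le> 2 * L\<close> truncated subtraction
  gives 0 and the bound is trivial.\<close>

lemma cell_count_ge:
  fixes u :: "real ^ 'n::finite"
  assumes "R1 > 0" "norm u / R1 + 1 \<le> real L"
  shows "real (k - 2 * L) ^ CARD('n) \<le> cell_count R1 k u"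
proof -
  let ?J = "PiE UNIV (\<lambda>_::'n. {L..<k - L})"
  have J: "?J \<subseteq> cells k"
    by (auto simp: cells_def PiE_def Pi_def) (meson atLeastLessThan_iff less_imp_diff_less less_le_trans diff_le_self)
  have in_cube: "u + cell_center R1 k j \<in> cube (k * R1)" if "j \<in> ?J" for j
    unfolding cube_def
  proof safe
    fix i
    have "\<bar>u $ i\<bar> / R1 \<le> norm u / R1"
      using assms(1) by (intro divide_right_mono component_le_norm_cart) auto
    then have "\<bar>u $ i / R1\<bar> + 1 \<le> real L"
      using assms by simp
    then have u: "- (u $ i / R1) + 1 \<le> real L" "u $ i / R1 + 1 \<le> real L"
      using abs_ge_self[of "u $ i / R1"] abs_ge_minus_self[of "u $ i / R1"] by (meson add_right_mono order_trans)+
    have "L \<le> j i" "j i < k - L"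
      using that by (auto simp: PiE_def Pi_def)
    then have j: "real L \<le> real (j i)" "real (j i) + 1 \<le> real k - real L"
      by linarith+
    define w where "w = u $ i / R1"
    have c: "(u + cell_center R1 k j) $ i = R1 * (w + (real (j i) - (real k - 1) / 2))"
      using assms(1) by (simp add: cell_center_def distrib_left w_def)
    note u = u[folded w_def]
    have "- (real k / 2) \<le> w + (real (j i) - (real k - 1) / 2)"
      using u(1) j(1) by (simp add: diff_divide_distrib)
    then have "R1 * (- (real k / 2)) \<le> R1 * (w + (real (j i) - (real k - 1) / 2))"
      using assms(1) by (intro mult_left_mono) auto
    then show "- (real k * R1 / 2) \<le> (u + cell_center R1 k j) $ i"
      unfolding c by (simp add: mult.commute)
    have "w + (real (j i) - (real k - 1) / 2) < real k / 2"
      using u(2) j(2) by (simp add: diff_divide_distrib)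
    then have "R1 * (w + (real (j i) - (real k - 1) / 2)) < R1 * (real k / 2)"
      using assms(1) by (intro mult_strict_left_mono) auto
    then show "(u + cell_center R1 k j) $ i < real k * R1 / 2"
      unfolding c by (simp add: mult.commute)
  qed
  have "real (k - 2 * L) ^ CARD('n) = (\<Sum>j\<in>?J. indicator (cube (k * R1)) (u + cell_center R1 k j))"
    using in_cube by (simp add: card_PiE mult_2)
  also have "\<dots> \<le> cell_count R1 k u"
    unfolding cell_count_def using J by (intro sum_mono2) auto
  finally show ?thesis .
qed

lemma cell_count_tendsto:
  fixes u :: "real ^ 'n::finite"
  assumes "R1 > 0"
  shows "(\<lambda>k. cell_count R1 k u / real k ^ CARD('n)) \<longlonglongrightarrow> 1"
proof -
  obtain L :: nat where L: "norm u / R1 + 1 \<le> real L"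
    using real_arch_simple by blast
  have "(\<lambda>k. real (k - 2 * L) / real k) \<longlonglongrightarrow> 1"
    by real_asymp
  then have "(\<lambda>k. (real (k - 2 * L) / real k) ^ CARD('n)) \<longlonglongrightarrow> 1 ^ CARD('n)"
    by (rule tendsto_power)
  then have lim: "(\<lambda>k. (real (k - 2 * L) / real k) ^ CARD('n)) \<longlonglongrightarrow> 1"
    by simp
  show ?thesis
  proof (rule tendsto_sandwich[OF _ _ lim tendsto_const])
    show "\<forall>\<^sub>F k in sequentially. (real (k - 2 * L) / real k) ^ CARD('n) \<le> cell_count R1 k u / real k ^ CARD('n)"
      using cell_count_ge[OF assms L] by (intro always_eventually allI) (simp add: power_divide divide_right_mono)
    show "\<forall>\<^sub>F k in sequentially. cell_count R1 k u / real k ^ CARD('n) \<le> 1"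
      using cell_count_le[of R1 _ u] by (intro always_eventually allI) (auto simp: divide_le_eq_1 zero_less_power_eq)
  qed
qed

section \<open>Potentials of cubes\<close>

text \<open>Split at distance 1 from \<open>x\<close>: close by, \<open>f\<close> is bounded and the
  kernel integrable; further away, the kernel is at most 1 and \<open>f\<close> is integrable. The
  resulting bound does not involve \<open>x\<close>.\<close>

lemma riesz_convolution_bounded:
  fixes f :: "real ^ 'n::finite \<Rightarrow> real"
  assumes s: "0 < s" "s < real CARD('n)" and f: "integrable lborel f" "\<And>u. \<bar>f u\<bar> \<le> K"
  shows "integrable lborel (\<lambda>u. f u * riesz s (x - u))"
    and "\<bar>\<integral>u. f u * riesz s (x - u) \<partial>lborel\<bar> \<le>
      K * (\<integral>u. indicator (ball 0 1) u * norm (u :: real ^ 'n) powr (- s) \<partial>lborel) + (\<integral>u. \<bar>f u\<bar> \<partial>lborel)"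
proof -
  let ?n = "\<lambda>u::real^'n. indicator (ball 0 1) u * norm u powr (- s)"
  have K: "K \<ge> 0"
    using f(2)[of 0] by linarith
  have n: "integrable lborel ?n"
    using s by (intro powr_norm_integrable_near) auto
  have [measurable]: "?n \<in> borel_measurable borel"
    using n by auto
  have [measurable]: "f \<in> borel_measurable borel"
    using f(1) by auto
  have nx: "integrable lborel (\<lambda>u. ?n (x - u))" "(\<integral>u. ?n (x - u) \<partial>lborel) = (\<integral>u. ?n u \<partial>lborel)"
    using lborel_integrable_affine[OF n, of "- 1" x] lborel_integral_affine[of ?n "- 1" x] by simp_all
  have bound: "\<bar>f u * riesz s (x - u)\<bar> \<le> K * ?n (x - u) + \<bar>f u\<bar>" for u
  proof (cases "norm (x - u) < 1")
    case True
    then have "\<bar>f u * riesz s (x - u)\<bar> \<le> K * riesz s (x - u)"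
      by (simp add: abs_mult mult_right_mono f(2))
    then show ?thesis
      using True by (simp add: riesz_def)
  next
    case False
    then have "riesz s (x - u) \<le> 1"
      using s powr_mono2'[of "- s" 1 "norm (x - u)"] by (simp add: riesz_def)
    then have "\<bar>f u\<bar> * riesz s (x - u) \<le> \<bar>f u\<bar> * 1"
      by (intro mult_left_mono) auto
    then show ?thesis
      using False by (simp add: abs_mult)
  qed
  have b: "integrable lborel (\<lambda>u. K * ?n (x - u) + \<bar>f u\<bar>)"
    by (intro Bochner_Integration.integrable_add integrable_mult_right nx integrable_abs f)
  show i: "integrable lborel (\<lambda>u. f u * riesz s (x - u))"
    by (rule Bochner_Integration.integrable_bound[OF b])
      (use bound in \<open>auto intro!: AE_I2 order_trans[OF _ abs_ge_self]\<close>)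
  have "\<bar>\<integral>u. f u * riesz s (x - u) \<partial>lborel\<bar> \<le> (\<integral>u. \<bar>f u * riesz s (x - u)\<bar> \<partial>lborel)"
    by (rule integral_abs_bound)
  also have "\<dots> \<le> (\<integral>u. K * ?n (x - u) + \<bar>f u\<bar> \<partial>lborel)"
    by (intro integral_mono integrable_abs i b bound)
  also have "\<dots> = K * (\<integral>u. ?n u \<partial>lborel) + (\<integral>u. \<bar>f u\<bar> \<partial>lborel)"
    using nx f(1) by (subst Bochner_Integration.integral_add) auto
  finally show "\<bar>\<integral>u. f u * riesz s (x - u) \<partial>lborel\<bar> \<le>
      K * (\<integral>u. indicator (ball 0 1) u * norm (u :: real ^ 'n) powr (- s) \<partial>lborel) + (\<integral>u. \<bar>f u\<bar> \<partial>lborel)" .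
qed

definition cube_potential :: "real \<Rightarrow> real \<Rightarrow> real ^ 'n::finite \<Rightarrow> real" where
  "cube_potential s R x = (\<integral>u. indicator (cube R) u * riesz s (x - u) \<partial>lborel)"

lemma borel_measurable_cube_potential [measurable]: "cube_potential s R \<in> borel_measurable borel"
  unfolding cube_potential_def by measurable

lemma cube_potential_bounded:
  assumes "0 < s" "s < real CARD('n)" "R \<ge> 0"
  obtains K where "\<And>x :: real ^ 'n::finite. \<bar>cube_potential s R x\<bar> \<le> K"
proof
  fix x :: "real ^ 'n"
  show "\<bar>cube_potential s R x\<bar> \<le> 1 * (\<integral>u. indicator (ball 0 1) u * norm (u :: real ^ 'n) powr (- s) \<partial>lborel)
      + (\<integral>u. \<bar>indicator (cube R :: (real ^ 'n) set) u\<bar> \<partial>lborel)"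
    unfolding cube_potential_def using assms
    by (intro riesz_convolution_bounded) (auto split: split_indicator)
qed

text \<open>The reflected half-open cube agrees with the cube only almost everywhere, which the
  integral does not see.\<close>

lemma cube_potential_uminus: "cube_potential s R (- x) = cube_potential s R (x :: real ^ 'n::finite)"
proof -
  have "cube_potential s R (- x) = (\<integral>u. indicator (cube R) (- u) * riesz s (- x - - u) \<partial>lborel)"
    unfolding cube_potential_def
    using lborel_integral_affine[of "\<lambda>u. indicator (cube R) u * riesz s (- x - u)" "- 1" 0] by simp
  also have "\<dots> = (\<integral>u. indicator (cube R) (- u) * riesz s (x - u) \<partial>lborel)"
    using riesz_minus[of s "x - u" for u] by simp
  also have "\<dots> = cube_potential s R x"
    unfolding cube_potential_def
  proof (rule integral_cong_AE)
    show "AE u in lborel. indicator (cube R) (- u) * riesz s (x - u) = indicator (cube R) u * riesz s (x - u)"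
      using AE_cube_uminus[of R, where 'n = 'n] by eventually_elim (simp add: indicator_def)
  qed measurable
  finally show ?thesis .
qed

text \<open>This is \<open>k ^ d\<close> times the mean called \<open>T\<close> in the overview;
  cutting integrals and point sums into cells produces the sum without normalisation.\<close>

definition lattice_potential :: "real \<Rightarrow> real \<Rightarrow> nat \<Rightarrow> real ^ 'n::finite \<Rightarrow> real" where
  "lattice_potential s R1 k y = (\<Sum>j\<in>cells k. cube_potential s (k * R1) (y + cell_center R1 k j))"

lemma borel_measurable_lattice_potential [measurable]: "lattice_potential s R1 k \<in> borel_measurable borel"
  unfolding lattice_potential_def by measurable

text \<open>Both ingredients are even, the potential of the cube and the set of centres. The
  symmetry belongs to the background alone and asks nothing of the point configuration.\<close>

lemma lattice_potential_uminus: "lattice_potential s R1 k (- y) = lattice_potential s R1 k y"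
proof -
  have "lattice_potential s R1 k (- y) = (\<Sum>j\<in>cells k. cube_potential s (k * R1) (y + - cell_center R1 k j))"
    unfolding lattice_potential_def
  proof (rule sum.cong)
    fix j
    show "cube_potential s (k * R1) (- y + cell_center R1 k j) = cube_potential s (k * R1) (y + - cell_center R1 k j)"
      using cube_potential_uminus[of s "k * R1" "y + - cell_center R1 k j"] by simp
  qed simp
  also have "\<dots> = lattice_potential s R1 k y"
    unfolding lattice_potential_def by (rule sum_cells_reflect)
  finally show ?thesis .
qed

text \<open>Substituting \<open>u + v\<close> for \<open>u\<close> moves each centre from the
  argument of the potential into the indicator. Afterwards \<open>y\<close> occurs in the kernel
  only, ready for differencing.\<close>

lemma lattice_potential_eq_cell_count:
  fixes y :: "real ^ 'n::finite"
  assumes s: "0 < s" "s < real CARD('n)" and "R1 > 0"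
  shows "integrable lborel (\<lambda>u. cell_count R1 k u * riesz s (y - u))"
    and "lattice_potential s R1 k y = (\<integral>u. cell_count R1 k u * riesz s (y - u) \<partial>lborel)"
proof -
  have R: "real k * R1 \<ge> 0"
    using assms by simp
  have ind: "integrable lborel (\<lambda>u. indicator (cube (k * R1)) (u + v) * riesz s (y - u))"
    and eq: "cube_potential s (k * R1) (y + v) = (\<integral>u. indicator (cube (k * R1)) (u + v) * riesz s (y - u) \<partial>lborel)"
    for v :: "real ^ 'n"
  proof -
    have i: "integrable lborel (\<lambda>u. indicator (cube (k * R1)) u * riesz s (y + v - u))"
      using R s by (intro riesz_convolution_bounded[where K = 1]) (auto split: split_indicator)
    show "integrable lborel (\<lambda>u. indicator (cube (k * R1)) (u + v) * riesz s (y - u))"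
      using lborel_integrable_affine[OF i, of 1 v] by (simp add: add.commute)
    show "cube_potential s (k * R1) (y + v) = (\<integral>u. indicator (cube (k * R1)) (u + v) * riesz s (y - u) \<partial>lborel)"
      unfolding cube_potential_def
      using lborel_integral_affine[of "\<lambda>u. indicator (cube (k * R1)) u * riesz s (y + v - u)" 1 v]
      by (simp add: add.commute)
  qed
  show "integrable lborel (\<lambda>u. cell_count R1 k u * riesz s (y - u))"
    unfolding cell_count_def sum_distrib_right by (intro Bochner_Integration.integrable_sum ind)
  show "lattice_potential s R1 k y = (\<integral>u. cell_count R1 k u * riesz s (y - u) \<partial>lborel)"
    unfolding cell_count_def sum_distrib_right lattice_potential_def eq
    by (rule Bochner_Integration.integral_sum[symmetric]) (rule ind)
qed

text \<open>By evenness the values at \<open>y\<close> and \<open>- y\<close> agree, so the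
  difference is half of a symmetric second difference, whose kernel has an integrable bound
  independent of \<open>k\<close>.\<close>

lemma lattice_potential_diff:
  fixes y :: "real ^ 'n::finite"
  assumes s: "0 < s" "s < real CARD('n)" and "R1 > 0"
  shows "lattice_potential s R1 k y - lattice_potential s R1 k (0 :: real ^ 'n) =
    (\<integral>u. cell_count R1 k u * second_difference s y u \<partial>lborel) / 2"
proof -
  let ?L = "lattice_potential s R1 k :: real ^ 'n \<Rightarrow> real"
  note int = lattice_potential_eq_cell_count(1)[OF assms, of k] and eq = lattice_potential_eq_cell_count(2)[OF assms, of k]
  have "?L y + ?L (- y) - 2 * ?L 0 =
      (\<integral>u. cell_count R1 k u * riesz s (y - u) + cell_count R1 k u * riesz s (- y - u)
        - 2 * (cell_count R1 k u * riesz s (0 - u)) \<partial>lborel)"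
    unfolding eq using int[of y] int[of "- y"] int[of 0] by simp
  also have "\<dots> = (\<integral>u. cell_count R1 k u * second_difference s y u \<partial>lborel)"
  proof (rule Bochner_Integration.integral_cong[OF refl])
    fix u
    have "riesz s (y - u) = riesz s (u - y)" "riesz s (- y - u) = riesz s (u + y)" "riesz s (0 - u) = riesz s u"
      using riesz_minus[of s "u - y"] riesz_minus[of s "u + y"] riesz_minus[of s u]
      by (simp_all only: minus_diff_eq minus_add_distrib diff_conv_add_uminus[symmetric] diff_0 minus_diff_commute)
    then show "cell_count R1 k u * riesz s (y - u) + cell_count R1 k u * riesz s (- y - u)
        - 2 * (cell_count R1 k u * riesz s (0 - u)) = cell_count R1 k u * second_difference s y u"
      by (simp only: second_difference_def) (simp add: algebra_simps)
  qed
  finally show ?thesis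
    unfolding lattice_potential_uminus by simp
qed

text \<open>\<open>T y - T 0\<close> in the notation of the overview.\<close>

definition potential_oscillation :: "real \<Rightarrow> real \<Rightarrow> nat \<Rightarrow> real ^ 'n::finite \<Rightarrow> real" where
  "potential_oscillation s R1 k y =
    (lattice_potential s R1 k y - lattice_potential s R1 k (0 :: real ^ 'n)) / real k ^ CARD('n)"

lemma borel_measurable_potential_oscillation [measurable]:
  "potential_oscillation s R1 k \<in> borel_measurable borel"
  unfolding potential_oscillation_def by measurable

lemma potential_oscillation_eq:
  fixes y :: "real ^ 'n::finite"
  assumes s: "0 < s" "s < real CARD('n)" and "R1 > 0"
  shows "potential_oscillation s R1 k y =
    (\<integral>u. cell_count R1 k u / real k ^ CARD('n) * second_difference s y u \<partial>lborel) / 2"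
  unfolding potential_oscillation_def lattice_potential_diff[OF assms] by simp

lemma potential_oscillation_tendsto:
  fixes y :: "real ^ 'n::finite"
  assumes s: "0 < s" "real CARD('n) - 2 < s" "s < real CARD('n)" and R1: "R1 > 0"
  shows "(\<lambda>k. potential_oscillation s R1 k y) \<longlonglongrightarrow> 0"
proof -
  have int: "integrable lborel (second_difference s y)"
    using second_difference_integrable[OF s, where B = "norm y"] by blast
  have "(\<lambda>k. \<integral>u. cell_count R1 k u / real k ^ CARD('n) * second_difference s y u \<partial>lborel)
      \<longlonglongrightarrow> (\<integral>u. second_difference s y u \<partial>lborel)"
  proof (rule integral_dominated_convergence[where w = "\<lambda>u. \<bar>second_difference s y u\<bar>"])
    show "AE u in lborel. (\<lambda>k. cell_count R1 k u / real k ^ CARD('n) * second_difference s y u)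
        \<longlonglongrightarrow> second_difference s y u"
      using tendsto_mult[OF cell_count_tendsto[OF R1] tendsto_const] by (intro AE_I2) fastforce
    show "AE u in lborel. norm (cell_count R1 k u / real k ^ CARD('n) * second_difference s y u)
        \<le> \<bar>second_difference s y u\<bar>" for k
    proof (intro AE_I2)
      fix u :: "real ^ 'n"
      have "\<bar>cell_count R1 k u / real k ^ CARD('n)\<bar> \<le> 1"
        using cell_count_le[of R1 k u] cell_count_nonneg[of R1 k u] by (auto simp: divide_le_eq_1 zero_less_power_eq)
      then show "norm (cell_count R1 k u / real k ^ CARD('n) * second_difference s y u) \<le> \<bar>second_difference s y u\<bar>"
        unfolding real_norm_def abs_mult by (rule mult_left_le_one_le[rotated 2]) auto
    qed
  qed (use int in auto)
  then show ?thesis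
    unfolding potential_oscillation_eq[OF s(1,3) R1] second_difference_integral_eq_0[OF s]
    by (auto dest: tendsto_divide_zero)
qed

text \<open>Uniformity in \<open>k\<close> holds because the normalised weight never exceeds 1. The
  bound later dominates integrals over a single cell.\<close>

lemma potential_oscillation_bounded:
  assumes s: "0 < s" "real CARD('n) - 2 < s" "s < real CARD('n)" and R1: "R1 > 0"
  obtains C where "\<And>k (y :: real ^ 'n::finite). norm y \<le> B \<Longrightarrow> \<bar>potential_oscillation s R1 k y\<bar> \<le> C"
proof -
  obtain C where C: "\<And>y :: real ^ 'n. norm y \<le> B \<Longrightarrow> (\<integral>x. \<bar>second_difference s y x\<bar> \<partial>lborel) \<le> C"
    and int: "\<And>y :: real ^ 'n. norm y \<le> B \<Longrightarrow> integrable lborel (second_difference s y)"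
    using second_difference_integrable[OF s, where B = B] by metis
  show ?thesis
  proof
    fix k and y :: "real ^ 'n" assume y: "norm y \<le> B"
    let ?f = "\<lambda>u. cell_count R1 k u / real k ^ CARD('n) * second_difference s y u"
    have bound: "\<bar>?f u\<bar> \<le> \<bar>second_difference s y u\<bar>" for u
    proof -
      have "\<bar>cell_count R1 k u / real k ^ CARD('n)\<bar> \<le> 1"
        using cell_count_le[of R1 k u] cell_count_nonneg[of R1 k u] by (auto simp: divide_le_eq_1 zero_less_power_eq)
      then show ?thesis
        unfolding abs_mult by (rule mult_left_le_one_le[rotated 2]) auto
    qed
    have f: "integrable lborel ?f"
      by (rule Bochner_Integration.integrable_bound[OF int[OF y]]) (use bound in auto)
    have "\<bar>\<integral>u. ?f u \<partial>lborel\<bar> \<le> (\<integral>u. \<bar>?f u\<bar> \<partial>lborel)"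
      by (rule integral_abs_bound)
    also have "\<dots> \<le> (\<integral>u. \<bar>second_difference s y u\<bar> \<partial>lborel)"
      by (intro integral_mono integrable_abs f int y bound)
    also have "\<dots> \<le> C"
      by (rule C[OF y])
    finally show "\<bar>potential_oscillation s R1 k y\<bar> \<le> C / 2"
      unfolding potential_oscillation_eq[OF s(1,3) R1] by simp
  qed
qed

lemma potential_oscillation_cube_integral_tendsto:
  fixes v :: "real ^ 'n::finite"
  assumes s: "0 < s" "real CARD('n) - 2 < s" "s < real CARD('n)" and R1: "R1 > 0"
  shows "(\<lambda>k. \<integral>x. indicator (cube R1) x * potential_oscillation s R1 k (x + v) \<partial>lborel) \<longlonglongrightarrow> 0"
proof -
  define B where "B = real CARD('n) * (R1 / 2) + norm v"
  obtain C where C: "\<And>k (y :: real ^ 'n). norm y \<le> B \<Longrightarrow> \<bar>potential_oscillation s R1 k y\<bar> \<le> C"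
    using potential_oscillation_bounded[OF s R1] by metis
  have "(\<lambda>k. \<integral>x. indicator (cube R1) x * potential_oscillation s R1 k (x + v) \<partial>lborel)
      \<longlonglongrightarrow> integral\<^sup>L (lborel :: (real ^ 'n) measure) (\<lambda>_. 0)"
  proof (rule integral_dominated_convergence[where w = "\<lambda>x. C * indicator (cube R1) x"])
    show "AE x in lborel. (\<lambda>k. indicator (cube R1) x * potential_oscillation s R1 k (x + v)) \<longlonglongrightarrow> 0"
      using potential_oscillation_tendsto[OF s R1] by (intro AE_I2 tendsto_mult_right_zero)
    show "AE x in lborel. norm (indicator (cube R1) x * potential_oscillation s R1 k (x + v)) \<le> C * indicator (cube R1) x" for k
    proof (intro AE_I2)
      fix x :: "real ^ 'n"
      have "norm (x + v) \<le> B" if "x \<in> cube R1"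
        using norm_cube_le[OF that] norm_triangle_ineq[of x v] by (simp add: B_def)
      then show "norm (indicator (cube R1) x * potential_oscillation s R1 k (x + v)) \<le> C * indicator (cube R1) x"
        using C by (simp add: indicator_def)
    qed
  qed (use R1 in auto)
  then show ?thesis by simp
qed

section \<open>Energies of periodic configurations\<close>

text \<open>The kernel and the density are nonnegative, so Tonelli applies without prior
  integrability on the product space; the convolution bound makes the inner integral finite at every
  \<open>x\<close>.\<close>

lemma self_energy_density:
  fixes f :: "real ^ 'n::finite \<Rightarrow> real"
  assumes s: "0 < s" "s < real CARD('n)"
    and f: "integrable lborel f" "\<And>u. 0 \<le> f u" "\<And>u. f u \<le> K"
  shows "self_energy s (density lborel (\<lambda>x. ennreal (f x))) =
    (\<integral>x. f x * (\<integral>u. f u * riesz s (x - u) \<partial>lborel) \<partial>lborel)"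
proof -
  have [measurable]: "f \<in> borel_measurable borel"
    using f(1) by auto
  let ?M = "density lborel (\<lambda>x. ennreal (f x))"
  let ?V = "\<lambda>x. \<integral>u. f u * riesz s (x - u) \<partial>lborel"
  have abs_f: "\<bar>f u\<bar> \<le> K" for u
    using f(2,3)[of u] by simp
  have "finite_measure ?M"
  proof
    have "emeasure ?M (space ?M) = ennreal (\<integral>x. f x \<partial>lborel)"
      by (simp add: emeasure_density nn_integral_eq_integral f)
    then show "emeasure ?M (space ?M) \<noteq> \<infinity>"
      by simp
  qed
  then interpret M: finite_measure ?M .
  have V_nonneg: "?V x \<ge> 0" for x
    using f(2) by (intro Bochner_Integration.integral_nonneg) auto
  have "self_energy s ?M = enn2real (\<integral>\<^sup>+z. ennreal (riesz s (fst z - snd z)) \<partial>(?M \<Otimes>\<^sub>M ?M))"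
    unfolding self_energy_def by (rule integral_eq_nn_integral) auto
  also have "(\<integral>\<^sup>+z. ennreal (riesz s (fst z - snd z)) \<partial>(?M \<Otimes>\<^sub>M ?M))
      = (\<integral>\<^sup>+x. \<integral>\<^sup>+u. ennreal (riesz s (x - u)) \<partial>?M \<partial>?M)"
    by (subst M.nn_integral_fst[symmetric]) simp_all
  also have "\<dots> = (\<integral>\<^sup>+x. ennreal (?V x) \<partial>?M)"
  proof (rule nn_integral_cong)
    fix x
    have "(\<integral>\<^sup>+u. ennreal (riesz s (x - u)) \<partial>?M) = (\<integral>\<^sup>+u. ennreal (f u * riesz s (x - u)) \<partial>lborel)"
      by (simp add: nn_integral_density ennreal_mult f(2))
    also have "\<dots> = ennreal (?V x)"
      by (rule nn_integral_eq_integral[OF riesz_convolution_bounded(1)[OF s f(1) abs_f]]) (simp add: f(2))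
    finally show "(\<integral>\<^sup>+u. ennreal (riesz s (x - u)) \<partial>?M) = ennreal (?V x)" .
  qed
  also have "\<dots> = (\<integral>\<^sup>+x. ennreal (f x * ?V x) \<partial>lborel)"
    by (simp add: nn_integral_density ennreal_mult f(2) V_nonneg)
  also have "enn2real \<dots> = (\<integral>x. f x * ?V x \<partial>lborel)"
    by (rule integral_eq_nn_integral[symmetric]) (auto simp: f(2) V_nonneg)
  finally show ?thesis .
qed

lemma integrable_cube_bounded:
  fixes F :: "real ^ 'n::finite \<Rightarrow> real"
  assumes [measurable]: "F \<in> borel_measurable borel" and "\<And>x. \<bar>F x\<bar> \<le> K" "R \<ge> 0"
  shows "integrable lborel (\<lambda>x. indicator (cube R) x * F x)"
proof (rule Bochner_Integration.integrable_bound[where f = "\<lambda>x. K * indicator (cube R) x"])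
  show "AE x in lborel. norm (indicator (cube R) x * F x) \<le> norm (K * indicator (cube R) x)"
    using assms(2) by (intro AE_I2) (auto split: split_indicator intro: order_trans[OF _ abs_ge_self])
qed (use assms(3) in auto)

lemma cube_integral_eq_sum_cells:
  fixes F :: "real ^ 'n::finite \<Rightarrow> real"
  assumes F [measurable]: "F \<in> borel_measurable borel" and K: "\<And>x. \<bar>F x\<bar> \<le> K" and R1: "R1 > 0"
  shows "(\<integral>x. indicator (cube (k * R1)) x * F x \<partial>lborel) =
    (\<integral>x. indicator (cube R1) x * (\<Sum>j\<in>cells k. F (x + cell_center R1 k j)) \<partial>lborel)"
proof -
  have int: "integrable lborel (\<lambda>x. indicator (cube R1) x * F (x + v))" for v
    using K R1 by (intro integrable_cube_bounded[where K = K]) auto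
  have int': "integrable lborel (\<lambda>x. indicator (cube R1) (x - v) * F x)"
    and eq: "(\<integral>x. indicator (cube R1) (x - v) * F x \<partial>lborel) = (\<integral>x. indicator (cube R1) x * F (x + v) \<partial>lborel)"
    for v
    using lborel_integrable_affine[OF int[of v], of 1 "- v"]
      lborel_integral_affine[of "\<lambda>x. indicator (cube R1) x * F (x + v)" 1 "- v"] by simp_all
  have "(\<integral>x. indicator (cube (k * R1)) x * F x \<partial>lborel) =
      (\<integral>x. (\<Sum>j\<in>cells k. indicator (cube R1) (x - cell_center R1 k j) * F x) \<partial>lborel)"
    unfolding sum_indicator_cells[OF R1, symmetric] sum_distrib_right ..
  also have "\<dots> = (\<Sum>j\<in>cells k. \<integral>x. indicator (cube R1) x * F (x + cell_center R1 k j) \<partial>lborel)"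
    by (subst Bochner_Integration.integral_sum) (use int' eq in auto)
  also have "\<dots> = (\<integral>x. indicator (cube R1) x * (\<Sum>j\<in>cells k. F (x + cell_center R1 k j)) \<partial>lborel)"
    unfolding sum_distrib_left by (subst Bochner_Integration.integral_sum) (use int in auto)
  finally show ?thesis .
qed

text \<open>Cutting the outer integral into cells produces the sum over centres. Background energies
  thus become integrals over one cell of fixed size, with \<open>k\<close> confined to the
  integrand.\<close>

lemma cube_integral_cube_potential:
  fixes v :: "real ^ 'n::finite"
  assumes s: "0 < s" "s < real CARD('n)" and R1: "R1 > 0"
  shows "(\<integral>x. indicator (cube (k * R1)) x * cube_potential s (k * R1) (x + v) \<partial>lborel) =
    (\<integral>x. indicator (cube R1) x * lattice_potential s R1 k (x + v) \<partial>lborel)"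
proof -
  have "real k * R1 \<ge> 0"
    using R1 by simp
  then obtain K where K: "\<And>x :: real ^ 'n. \<bar>cube_potential s (k * R1) x\<bar> \<le> K"
    using cube_potential_bounded[OF s] by blast
  show ?thesis
    using cube_integral_eq_sum_cells[of "\<lambda>x. cube_potential s (k * R1) (x + v)", OF _ K R1, of k]
    by (simp add: lattice_potential_def add_ac)
qed

lemma cube_measure_eq_density:
  "cube_measure R = density lborel (\<lambda>x. ennreal (indicator (cube R) x))"
  by (simp add: cube_measure_def ennreal_indicator)

lemma integral_cube_measure:
  fixes f :: "real ^ 'n::finite \<Rightarrow> 'b::{banach, second_countable_topology}"
  assumes "f \<in> borel_measurable borel"
  shows "(\<integral>x. f x \<partial>cube_measure R) = (\<integral>x. indicator (cube R) x *\<^sub>R f x \<partial>lborel)"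
  unfolding cube_measure_eq_density using assms by (subst integral_density) auto

lemma self_energy_cube_measure:
  assumes s: "0 < s" "s < real CARD('n)" and R1: "R1 > 0"
  shows "self_energy s (cube_measure (k * R1) :: (real ^ 'n::finite) measure) =
    (\<integral>x. indicator (cube R1) x * lattice_potential s R1 k (x :: real ^ 'n) \<partial>lborel)"
proof -
  have "self_energy s (cube_measure (k * R1) :: (real ^ 'n) measure) =
      (\<integral>x. indicator (cube (k * R1)) x * cube_potential s (k * R1) (x :: real ^ 'n) \<partial>lborel)"
    unfolding cube_measure_eq_density cube_potential_def using R1
    by (intro self_energy_density[OF s, where K = 1]) (auto split: split_indicator)
  then show ?thesis
    using cube_integral_cube_potential[OF s R1, of k "0 :: real ^ 'n"] by simp
qed

section \<open>Point patterns of the cells\<close>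

definition cell_points :: "real \<Rightarrow> (real ^ 'n::finite) set \<Rightarrow> nat \<Rightarrow> (real ^ 'n) set" where
  "cell_points R1 P k = {c \<in> cube R1. cell_center R1 k (\<lambda>_. 0) + c \<in> P}"

lemma lattice_periodic_add:
  assumes "lattice_periodic R1 P" "v \<in> scaled_lattice R1" "p \<in> P"
  shows "p + v \<in> P"
  using assms unfolding lattice_periodic_def by blast

lemma scaled_lattice_uminus: "v \<in> scaled_lattice R1 \<Longrightarrow> - v \<in> scaled_lattice R1"
  unfolding scaled_lattice_def by safe (metis Ints_minus scaleR_minus_right vector_uminus_component)

lemma lattice_periodic_iff:
  assumes "lattice_periodic R1 P" "v \<in> scaled_lattice R1"
  shows "p + v \<in> P \<longleftrightarrow> p \<in> P"
  using lattice_periodic_add[OF assms] lattice_periodic_add[OF assms(1) scaled_lattice_uminus[OF assms(2)], of "p + v"]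
  by auto

text \<open>For one \<open>k\<close> all centres differ by lattice vectors, so every cell shows the
  same pattern relative to its centre, and the index 0 in the definition is an arbitrary
  reference.\<close>

lemma cell_points_iff:
  assumes "lattice_periodic R1 P"
  shows "c \<in> cell_points R1 P k \<longleftrightarrow> c \<in> cube R1 \<and> cell_center R1 k j + c \<in> P"
proof -
  have "cell_center R1 k j - cell_center R1 k (\<lambda>_. 0) = R1 *\<^sub>R (\<chi> i. real (j i))"
    by (simp add: cell_center_def vec_eq_iff algebra_simps)
  then have "cell_center R1 k j - cell_center R1 k (\<lambda>_. 0) \<in> scaled_lattice R1"
    unfolding scaled_lattice_def by auto
  from lattice_periodic_iff[OF assms this, of "cell_center R1 k (\<lambda>_. 0) + c"] show ?thesis
    by (simp add: cell_points_def algebra_simps)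
qed

text \<open>Raising \<open>k\<close> by 2 moves the reference centre by a lattice vector. Hence only
  two patterns occur, and for fixed parity the sums in the limits run over a fixed finite
  set.\<close>

lemma cell_points_mod_2:
  assumes "lattice_periodic R1 P"
  shows "cell_points R1 P k = cell_points R1 P (k mod 2)"
proof -
  have k: "real k = real (k mod 2) + 2 * real (k div 2)"
    by (metis mod_mult_div_eq of_nat_add of_nat_mult of_nat_numeral)
  have "cell_center R1 (k mod 2) (\<lambda>_. 0) - cell_center R1 k (\<lambda>_. 0) = R1 *\<^sub>R (\<chi> i. real (k div 2))"
    using k[THEN arg_cong[where f = "\<lambda>x. R1 * x"]] by (simp add: cell_center_def vec_eq_iff field_simps)
  then have "cell_center R1 (k mod 2) (\<lambda>_. 0) - cell_center R1 k (\<lambda>_. 0) \<in> scaled_lattice R1"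
    unfolding scaled_lattice_def by auto
  from lattice_periodic_iff[OF assms this, of "cell_center R1 k (\<lambda>_. 0) + c" for c] show ?thesis
    by (auto simp: cell_points_def algebra_simps)
qed

lemma bounded_cube: "bounded (cube R :: (real ^ 'n::finite) set)"
  unfolding bounded_iff using norm_cube_le by blast

lemma finite_cell_points:
  fixes P :: "(real ^ 'n::finite) set"
  assumes "configuration P"
  shows "finite (cell_points R1 P k)"
proof -
  let ?z = "cell_center R1 k (\<lambda>_. 0) :: real ^ 'n"
  have "finite (P \<inter> (\<lambda>c. ?z + c) ` cube R1)"
    using assms bounded_cube unfolding configuration_def by (metis bounded_translation)
  then have "finite ((\<lambda>c. c - ?z) ` (P \<inter> (\<lambda>c. ?z + c) ` cube R1))"
    by simp
  moreover have "cell_points R1 P k \<subseteq> (\<lambda>c. c - ?z) ` (P \<inter> (\<lambda>c. ?z + c) ` cube R1)"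
    by (force simp: cell_points_def)
  ultimately show ?thesis
    by (rule finite_subset[rotated])
qed

text \<open>Together with the existence of representatives below, this makes the half-open cube a
  fundamental domain: two of its points differ by less than \<open>R1\<close> in each coordinate,
  and a nonzero integer has modulus at least 1.\<close>

lemma cube_lattice_eq:
  assumes R1: "R1 > 0" and "x \<in> cube R1" "y \<in> cube R1" "x - y \<in> scaled_lattice R1"
  shows "x = y"
proof -
  obtain z where z: "x - y = R1 *\<^sub>R z" "\<forall>i. z $ i \<in> \<int>"
    using assms(4) by (auto simp: scaled_lattice_def)
  have "z $ i = 0" for i
  proof -
    have "\<bar>(x - y) $ i\<bar> < R1"
      using assms(2,3) unfolding cube_def by (simp add: abs_less_iff) (smt (verit) field_sum_of_halves)
    then have "R1 * \<bar>z $ i\<bar> < R1 * 1"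
      using R1 by (simp add: z(1) abs_mult)
    then have "\<bar>z $ i\<bar> < 1"
      using R1 by (simp only: mult_less_cancel_left_pos)
    then show ?thesis
      using z(2) by (metis Ints_nonzero_abs_less1)
  qed
  then have "z = 0"
    by (simp add: vec_eq_iff)
  then show ?thesis
    using z(1) by simp
qed

lemma cube_lattice_representative:
  assumes R1: "R1 > 0"
  obtains y where "y \<in> cube R1" "y - x \<in> scaled_lattice R1"
proof
  define z :: "real ^ 'a" where "z = (\<chi> i. - of_int \<lfloor>x $ i / R1 + 1 / 2\<rfloor>)"
  define y where "y = x + R1 *\<^sub>R z"
  show "y - x \<in> scaled_lattice R1"
    by (auto simp: y_def scaled_lattice_def z_def)
  have "- (R1 / 2) \<le> y $ i \<and> y $ i < R1 / 2" for i
  proof -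
    define w where "w = x $ i / R1"
    have "y $ i = R1 * (w - of_int \<lfloor>w + 1 / 2\<rfloor>)"
      using R1 by (simp add: y_def z_def w_def right_diff_distrib)
    moreover have "- (1 / 2) \<le> w - of_int \<lfloor>w + 1 / 2\<rfloor>" "w - of_int \<lfloor>w + 1 / 2\<rfloor> < 1 / 2"
      by linarith+
    then have "R1 * (- (1 / 2)) \<le> R1 * (w - of_int \<lfloor>w + 1 / 2\<rfloor>)" "R1 * (w - of_int \<lfloor>w + 1 / 2\<rfloor>) < R1 * (1 / 2)"
      using R1 by (intro mult_left_mono mult_strict_left_mono; simp)+
    ultimately show ?thesis
      by simp
  qed
  then show "y \<in> cube R1"
    by (simp add: cube_def)
qed

text \<open>Translating by \<open>v\<close> and reducing modulo the lattice embeds the points of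
  \<open>P\<close> in the cube into those of \<open>Q\<close>. Applied in both directions, it yields
  equality of the counts.\<close>

lemma card_lattice_periodic_translate_le:
  fixes P Q :: "(real ^ 'n::finite) set"
  assumes R1: "R1 > 0" and "lattice_periodic R1 Q" and "\<And>x. x \<in> P \<Longrightarrow> x + v \<in> Q"
    and fin: "finite (Q \<inter> cube R1)"
  shows "card (P \<inter> cube R1) \<le> card (Q \<inter> cube R1)"
proof -
  have "\<forall>x. \<exists>y. y \<in> cube R1 \<and> y - (x + v) \<in> scaled_lattice R1"
    using cube_lattice_representative[OF R1] by metis
  then obtain h where h: "\<And>x. h x \<in> cube R1" "\<And>x. h x - (x + v) \<in> scaled_lattice R1"
    by metis
  have add: "a + b \<in> scaled_lattice R1" if "a \<in> scaled_lattice R1" "b \<in> scaled_lattice R1" for a b :: "real ^ 'n"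
    using that unfolding scaled_lattice_def
    by safe (metis (no_types, lifting) Ints_add scaleR_add_right vector_add_component)
  have "inj_on h (P \<inter> cube R1)"
  proof (rule inj_onI)
    fix x y assume x: "x \<in> P \<inter> cube R1" and y: "y \<in> P \<inter> cube R1" and eq: "h x = h y"
    have "x - y = - (h x - (x + v)) + (h y - (y + v))"
      using eq by simp
    then have "x - y \<in> scaled_lattice R1"
      using add[OF scaled_lattice_uminus[OF h(2)[of x]] h(2)[of y]] by simp
    then show "x = y"
      using cube_lattice_eq[OF R1] x y by blast
  qed
  moreover have "h ` (P \<inter> cube R1) \<subseteq> Q \<inter> cube R1"
  proof safe
    fix x assume "x \<in> P" "x \<in> cube R1"
    then show "h x \<in> cube R1" "h x \<in> Q"
      using h(1) lattice_periodic_add[OF assms(2) h(2)[of x] assms(3)[of x]] by auto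
  qed
  ultimately show ?thesis
    using fin by (rule card_inj_on_le)
qed

text \<open>For even \<open>k\<close> a cell is no lattice translate of \<open>cube R1\<close>, so
  the number of its points has to be transferred through periodicity, by the translations
  \<open>?z\<close> and \<open>- ?z\<close>.\<close>

lemma card_cell_points:
  fixes P :: "(real ^ 'n::finite) set"
  assumes R1: "R1 > 0" and P: "configuration P" "lattice_periodic R1 P"
  shows "card (cell_points R1 P k) = card (P \<inter> cube R1)"
proof -
  let ?z = "cell_center R1 k (\<lambda>_. 0) :: real ^ 'n"
  let ?Q = "{c. ?z + c \<in> P}"
  have Q: "cell_points R1 P k = ?Q \<inter> cube R1"
    by (auto simp: cell_points_def)
  have fin: "finite (P \<inter> cube R1)" "finite (?Q \<inter> cube R1)"
    using P(1) bounded_cube finite_cell_points[OF P(1), of R1 k] unfolding configuration_def Q by auto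
  have "lattice_periodic R1 ?Q"
    unfolding lattice_periodic_def
  proof safe
    fix v c :: "real ^ 'n" assume v: "v \<in> scaled_lattice R1"
    have shift: "?z + (c + v) \<in> P \<longleftrightarrow> ?z + c \<in> P" if "v \<in> scaled_lattice R1" for v c :: "real ^ 'n"
      using lattice_periodic_iff[OF P(2) that, of "?z + c"] by (simp add: add.assoc)
    show "?z + (c + v) \<in> P" if "?z + c \<in> P"
      using shift[OF v] that by simp
    show "c \<in> (\<lambda>p. p + v) ` ?Q" if "?z + c \<in> P"
      using shift[OF scaled_lattice_uminus[OF v], of c] that by (intro image_eqI[of _ _ "c - v"]) auto
  qed
  then have "card (P \<inter> cube R1) \<le> card (?Q \<inter> cube R1)"
    using R1 fin by (intro card_lattice_periodic_translate_le[where v = "- ?z"]) auto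
  moreover have "card (?Q \<inter> cube R1) \<le> card (P \<inter> cube R1)"
    using R1 fin P by (intro card_lattice_periodic_translate_le[where v = ?z]) (auto simp: add.commute)
  ultimately show ?thesis
    unfolding Q by simp
qed

lemma sum_points_eq_sum_cells:
  fixes P :: "(real ^ 'n::finite) set" and F :: "real ^ 'n \<Rightarrow> real"
  assumes R1: "R1 > 0" and P: "configuration P" "lattice_periodic R1 P"
  shows "(\<Sum>p\<in>P \<inter> cube (k * R1). F p) = (\<Sum>c\<in>cell_points R1 P k. \<Sum>j\<in>cells k. F (c + cell_center R1 k j))"
proof -
  let ?S = "P \<inter> cube (k * R1)"
  have fin: "finite ?S"
    using P(1) bounded_cube by (auto simp: configuration_def)
  have "(\<Sum>p\<in>?S. F p) = (\<Sum>p\<in>?S. indicator (cube (k * R1)) p * F p)"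
    by (intro sum.cong) auto
  also have "\<dots> = (\<Sum>p\<in>?S. \<Sum>j\<in>cells k. indicator (cube R1) (p - cell_center R1 k j) * F p)"
    unfolding sum_indicator_cells[OF R1, symmetric] sum_distrib_right ..
  also have "\<dots> = (\<Sum>j\<in>cells k. \<Sum>p\<in>?S. indicator (cube R1) (p - cell_center R1 k j) * F p)"
    by (rule sum.swap)
  also have "\<dots> = (\<Sum>j\<in>cells k. \<Sum>c\<in>cell_points R1 P k. F (c + cell_center R1 k j))"
  proof (rule sum.cong[OF refl])
    fix j :: "'n \<Rightarrow> nat" assume j: "j \<in> cells k"
    let ?z = "cell_center R1 k j"
    have "(\<Sum>p\<in>?S. indicator (cube R1) (p - ?z) * F p) = (\<Sum>p\<in>{p \<in> ?S. p - ?z \<in> cube R1}. F p)"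
      using fin by (intro sum.mono_neutral_cong_right) (auto simp: indicator_def)
    also have "{p \<in> ?S. p - ?z \<in> cube R1} = (\<lambda>c. c + ?z) ` cell_points R1 P k"
    proof safe
      fix p assume "p \<in> P" "p - ?z \<in> cube R1"
      then show "p \<in> (\<lambda>c. c + ?z) ` cell_points R1 P k"
        by (intro image_eqI[of _ _ "p - ?z"]) (auto simp: cell_points_iff[OF P(2), of _ _ j])
    next
      fix c assume c: "c \<in> cell_points R1 P k"
      then show "c + ?z \<in> P" "c + ?z - ?z \<in> cube R1"
        by (auto simp: cell_points_iff[OF P(2), of _ _ j] add.commute)
      \<comment> \<open>One cell indicator equals 1, so the sum over all cells is positive; by the
        tiling identity that sum is the indicator of the large cube.\<close>
      have "(indicator (cube R1) (c + ?z - ?z) :: real) \<le> (\<Sum>j\<in>cells k. indicator (cube R1) (c + ?z - cell_center R1 k j))"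
        by (rule member_le_sum[OF j, where f = "\<lambda>j. indicator (cube R1) (c + ?z - cell_center R1 k j)"]) auto
      then show "c + ?z \<in> cube (k * R1)"
        using c unfolding sum_indicator_cells[OF R1] by (auto simp: cell_points_def indicator_def split: if_splits)
    qed
    also have "(\<Sum>p\<in>(\<lambda>c. c + ?z) ` cell_points R1 P k. F p) = (\<Sum>c\<in>cell_points R1 P k. F (c + ?z))"
      by (subst sum.reindex) (auto simp: inj_on_def)
    finally show "(\<Sum>p\<in>?S. indicator (cube R1) (p - ?z) * F p) = (\<Sum>c\<in>cell_points R1 P k. F (c + ?z))" .
  qed
  also have "\<dots> = (\<Sum>c\<in>cell_points R1 P k. \<Sum>j\<in>cells k. F (c + cell_center R1 k j))"
    by (rule sum.swap)
  finally show ?thesis .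
qed

text \<open>Averaging spreads each point mass uniformly over a translated small cube. For a fixed
  position \<open>c\<close> within the cell these small cubes tile a large cube shifted by
  \<open>c\<close>, so the averaged measure is a superposition of shifted large cubes.\<close>

lemma averaged_measure_eq_density:
  fixes P :: "(real ^ 'n::finite) set"
  assumes R1: "R1 > 0" and P: "configuration P" "lattice_periodic R1 P"
  shows "averaged_measure (k * R1) R1 P = density lborel
    (\<lambda>x. ennreal ((\<Sum>c\<in>cell_points R1 P k. indicator (cube (k * R1)) (x - c)) / R1 ^ CARD('n)))"
proof (rule measure_eqI)
  let ?S = "P \<inter> cube (k * R1)"
  show "sets (averaged_measure (k * R1) R1 P) = sets (density lborel
    (\<lambda>x. ennreal ((\<Sum>c\<in>cell_points R1 P k. indicator (cube (k * R1)) (x - c)) / R1 ^ CARD('n))))"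
    unfolding averaged_measure_def by (simp add: sets.sigma_sets_eq[of borel, simplified])
  fix A assume "A \<in> sets (averaged_measure (k * R1) R1 P)"
  then have A [measurable]: "A \<in> sets borel"
    unfolding averaged_measure_def by (simp add: sets.sigma_sets_eq[of borel, simplified])
  have V: "R1 ^ CARD('n) > 0"
    using R1 by simp
  have shift: "(\<integral>\<^sup>+x. indicator A (p + x) * indicator (cube R1) x \<partial>lborel)
      = (\<integral>\<^sup>+x. ennreal (indicator (cube R1) (x - p)) * indicator A x \<partial>lborel)" for p :: "real ^ 'n"
    using lborel_nn_integral_affine[of "\<lambda>x. indicator A (p + x) * indicator (cube R1) x" 1 "- p"]
    by (simp add: ennreal_indicator mult.commute)
  have dens: "(\<Sum>p\<in>?S. indicator (cube R1) (x - p)) = (\<Sum>c\<in>cell_points R1 P k. indicator (cube (k * R1)) (x - c) :: real)" for x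
  proof -
    have "(\<Sum>p\<in>?S. indicator (cube R1) (x - p)) = (\<Sum>c\<in>cell_points R1 P k. \<Sum>j\<in>cells k. indicator (cube R1) ((x - c) - cell_center R1 k j) :: real)"
      by (subst sum_points_eq_sum_cells[OF R1 P]) (simp add: diff_diff_eq)
    then show ?thesis
      unfolding sum_indicator_cells[OF R1] .
  qed
  have "emeasure (averaged_measure (k * R1) R1 P) A =
    (1 / ennreal (R1 ^ CARD('n))) * (\<integral>\<^sup>+x\<in>cube R1. (\<Sum>p\<in>?S. emeasure (return borel (p + x)) A) \<partial>lborel)"
    using R1 by (simp add: emeasure_averaged_measure emeasure_cube)
  also have "(\<integral>\<^sup>+x\<in>cube R1. (\<Sum>p\<in>?S. emeasure (return borel (p + x)) A) \<partial>lborel)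
      = (\<Sum>p\<in>?S. \<integral>\<^sup>+x. indicator A (p + x) * indicator (cube R1) x \<partial>lborel)"
    by (simp add: sum_distrib_right nn_integral_sum)
  also have "\<dots> = (\<integral>\<^sup>+x. (\<Sum>p\<in>?S. ennreal (indicator (cube R1) (x - p))) * indicator A x \<partial>lborel)"
    unfolding shift by (subst nn_integral_sum[symmetric]) (simp_all add: sum_distrib_right del: sum_ennreal)
  also have "1 / ennreal (R1 ^ CARD('n)) * \<dots> =
      (\<integral>\<^sup>+x. ennreal ((\<Sum>c\<in>cell_points R1 P k. indicator (cube (k * R1)) (x - c)) / R1 ^ CARD('n)) * indicator A x \<partial>lborel)"
  proof (subst nn_integral_cmult[symmetric])
    have "1 / ennreal (R1 ^ CARD('n)) * ((\<Sum>p\<in>?S. ennreal (indicator (cube R1) (x - p))) * indicator A x) =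
        ennreal ((\<Sum>c\<in>cell_points R1 P k. indicator (cube (k * R1)) (x - c)) / R1 ^ CARD('n)) * indicator A x" for x
    proof -
      have "(\<Sum>p\<in>?S. ennreal (indicator (cube R1) (x - p))) = ennreal (\<Sum>c\<in>cell_points R1 P k. indicator (cube (k * R1)) (x - c))"
        unfolding dens[symmetric] by (rule sum_ennreal) auto
      moreover have "1 / ennreal (R1 ^ CARD('n)) = ennreal (1 / R1 ^ CARD('n))"
        using V divide_ennreal[of 1 "R1 ^ CARD('n)"] by simp
      ultimately show ?thesis
        using V by (simp add: ennreal_mult[symmetric] sum_nonneg mult.assoc[symmetric])
    qed
    then show "(\<integral>\<^sup>+x. 1 / ennreal (R1 ^ CARD('n)) * ((\<Sum>p\<in>?S. ennreal (indicator (cube R1) (x - p))) * indicator A x) \<partial>lborel)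
      = (\<integral>\<^sup>+x. ennreal ((\<Sum>c\<in>cell_points R1 P k. indicator (cube (k * R1)) (x - c)) / R1 ^ CARD('n)) * indicator A x \<partial>lborel)"
      by simp
  qed simp
  also have "\<dots> = emeasure (density lborel
    (\<lambda>x. ennreal ((\<Sum>c\<in>cell_points R1 P k. indicator (cube (k * R1)) (x - c)) / R1 ^ CARD('n)))) A"
    by (subst emeasure_density) auto
  finally show "emeasure (averaged_measure (k * R1) R1 P) A = emeasure (density lborel
    (\<lambda>x. ennreal ((\<Sum>c\<in>cell_points R1 P k. indicator (cube (k * R1)) (x - c)) / R1 ^ CARD('n)))) A" .
qed

text \<open>By bilinearity each pair of shifts contributes the interaction of two large cubes, and
  translation invariance leaves only the relative shift \<open>c - c'\<close>.\<close>

lemma self_energy_averaged_measure: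
  fixes P :: "(real ^ 'n::finite) set"
  assumes s: "0 < s" "s < real CARD('n)" and R1: "R1 > 0" and P: "configuration P" "lattice_periodic R1 P"
  shows "self_energy s (averaged_measure (k * R1) R1 P) =
    (\<Sum>c\<in>cell_points R1 P k. \<Sum>c'\<in>cell_points R1 P k.
      \<integral>x. indicator (cube R1) x * lattice_potential s R1 k (x + (c - c')) \<partial>lborel) / (R1 ^ CARD('n))\<^sup>2"
proof -
  let ?C = "cell_points R1 P k" and ?R = "real k * R1" and ?v = "R1 ^ CARD('n)"
  let ?f = "\<lambda>x. (\<Sum>c\<in>?C. indicator (cube ?R) (x - c)) / ?v :: real"
  have R: "?R \<ge> 0" and v: "?v > 0"
    using R1 by auto
  have ind: "integrable lborel (\<lambda>x. indicator (cube ?R) (x - c) :: real)" for c :: "real ^ 'n"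
    using lborel_integrable_affine[OF integrable_indicator_cube[OF R], of 1 "- c"] by simp
  have f: "integrable lborel ?f"
    by (intro integrable_divide Bochner_Integration.integrable_sum ind) 
  have V: "(\<integral>u. ?f u * riesz s (x - u) \<partial>lborel) = (\<Sum>c\<in>?C. cube_potential s ?R (x - c)) / ?v" for x
  proof -
    have i: "integrable lborel (\<lambda>u. indicator (cube ?R) (u - c) * riesz s (x - u))" for c
      by (intro riesz_convolution_bounded[OF s, where K = 1] ind) (auto split: split_indicator)
    have "(\<integral>u. indicator (cube ?R) (u - c) * riesz s (x - u) \<partial>lborel) = cube_potential s ?R (x - c)" for c
      unfolding cube_potential_def
      using lborel_integral_affine[of "\<lambda>u. indicator (cube ?R) (u - c) * riesz s (x - u)" 1 c]
      by (simp add: diff_diff_eq)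
    then show ?thesis
      using i by (simp add: sum_distrib_right)
  qed
  obtain K where K: "\<And>x :: real ^ 'n. \<bar>cube_potential s ?R x\<bar> \<le> K"
    using cube_potential_bounded[OF s R] by blast
  have i: "integrable lborel (\<lambda>x. indicator (cube ?R) (x - c) * cube_potential s ?R (x - c'))" 
    and eq: "(\<integral>x. indicator (cube ?R) (x - c) * cube_potential s ?R (x - c') \<partial>lborel) =
      (\<integral>x. indicator (cube R1) x * lattice_potential s R1 k (x + (c - c')) \<partial>lborel)" for c c' :: "real ^ 'n"
  proof -
    let ?F = "\<lambda>x. indicator (cube ?R) x * cube_potential s ?R (x + (c - c'))"
    have "integrable lborel ?F"
      using K R by (intro integrable_cube_bounded[where K = K]) auto
    from lborel_integrable_affine[OF this, of 1 "- c"]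
    show "integrable lborel (\<lambda>x. indicator (cube ?R) (x - c) * cube_potential s ?R (x - c'))"
      by simp
    have "(\<integral>x. ?F x \<partial>lborel) = (\<integral>x. indicator (cube ?R) (x - c) * cube_potential s ?R (x - c') \<partial>lborel)"
      using lborel_integral_affine[of ?F 1 "- c"] by simp
    then show "(\<integral>x. indicator (cube ?R) (x - c) * cube_potential s ?R (x - c') \<partial>lborel) =
      (\<integral>x. indicator (cube R1) x * lattice_potential s R1 k (x + (c - c')) \<partial>lborel)"
      using cube_integral_cube_potential[OF s R1, of k "c - c'"] by simp
  qed
  have "self_energy s (averaged_measure ?R R1 P) = (\<integral>x. ?f x * ((\<Sum>c\<in>?C. cube_potential s ?R (x - c)) / ?v) \<partial>lborel)"
    unfolding averaged_measure_eq_density[OF R1 P] V[symmetric]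
  proof (rule self_energy_density[OF s f])
    fix u
    show "0 \<le> ?f u"
      using v by (intro divide_nonneg_pos sum_nonneg) auto
    have "(\<Sum>c\<in>?C. indicator (cube ?R) (u - c) :: real) \<le> (\<Sum>c\<in>?C. 1)"
      by (intro sum_mono) (auto split: split_indicator)
    then show "?f u \<le> real (card ?C) / ?v"
      using v by (intro divide_right_mono) auto
  qed
  also have "\<dots> = (\<integral>x. (\<Sum>c\<in>?C. \<Sum>c'\<in>?C. indicator (cube ?R) (x - c) * cube_potential s ?R (x - c')) / ?v\<^sup>2 \<partial>lborel)"
    by (simp add: sum_product power2_eq_square)
  also have "\<dots> = (\<Sum>c\<in>?C. \<Sum>c'\<in>?C. \<integral>x. indicator (cube ?R) (x - c) * cube_potential s ?R (x - c') \<partial>lborel) / ?v\<^sup>2"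
    using i by simp
  finally show ?thesis
    unfolding eq .
qed

section \<open>The limits\<close>

text \<open>Isolates the divergent baseline. Its coefficient is the cell volume whatever
  \<open>v\<close> is, so it can cancel between terms with different displacements.\<close>

lemma cube_integral_lattice_potential:
  fixes v :: "real ^ 'n::finite"
  assumes s: "0 < s" "real CARD('n) - 2 < s" "s < real CARD('n)" and R1: "R1 > 0" and k: "k > 0"
  shows "(\<integral>x. indicator (cube R1) x * lattice_potential s R1 k (x + v) \<partial>lborel) =
    R1 ^ CARD('n) * lattice_potential s R1 k (0 :: real ^ 'n) +
    real k ^ CARD('n) * (\<integral>x. indicator (cube R1) x * potential_oscillation s R1 k (x + v) \<partial>lborel)"
proof -
  define B where "B = real CARD('n) * (R1 / 2) + norm v"
  obtain C where C: "\<And>k (y :: real ^ 'n). norm y \<le> B \<Longrightarrow> \<bar>potential_oscillation s R1 k y\<bar> \<le> C"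
    using potential_oscillation_bounded[OF s R1] by metis
  have i: "integrable lborel (\<lambda>x. indicator (cube R1) x * potential_oscillation s R1 k (x + v))"
  proof (rule Bochner_Integration.integrable_bound[where f = "\<lambda>x. C * indicator (cube R1) x"])
    show "AE x in lborel. norm (indicator (cube R1) x * potential_oscillation s R1 k (x + v)) \<le> norm (C * indicator (cube R1) x)"
    proof (intro AE_I2)
      fix x :: "real ^ 'n"
      have "norm (x + v) \<le> B" if "x \<in> cube R1"
        using norm_cube_le[OF that] norm_triangle_ineq[of x v] by (simp add: B_def)
      then show "norm (indicator (cube R1) x * potential_oscillation s R1 k (x + v)) \<le> norm (C * indicator (cube R1) x)"
        using C by (auto split: split_indicator intro: order_trans[OF _ abs_ge_self])
    qed
  qed (use R1 in auto)
  have eq: "lattice_potential s R1 k y = lattice_potential s R1 k (0 :: real ^ 'n) + real k ^ CARD('n) * potential_oscillation s R1 k y"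
    for y :: "real ^ 'n"
    using k by (simp add: potential_oscillation_def)
  have "(\<integral>x. indicator (cube R1) x * lattice_potential s R1 k (x + v) \<partial>lborel) =
    (\<integral>x. indicator (cube R1) x * lattice_potential s R1 k (0 :: real ^ 'n) +
      real k ^ CARD('n) * (indicator (cube R1) x * potential_oscillation s R1 k (x + v)) \<partial>lborel)"
    unfolding eq[of "x + v" for x] by (simp only: distrib_left mult.left_commute)
  also have "\<dots> = R1 ^ CARD('n) * lattice_potential s R1 k (0 :: real ^ 'n) +
    real k ^ CARD('n) * (\<integral>x. indicator (cube R1) x * potential_oscillation s R1 k (x + v) \<partial>lborel)"
    using i R1 by (subst Bochner_Integration.integral_add) (auto simp: measure_cube)
  finally show ?thesis .
qed

text \<open>The point energies cancel, leaving twice the interaction of points and background minus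
  twice the self energy of the background. Both contain the baseline with coefficient
  \<open>R1 ^ d\<close>: once as the number of points in a cell, once as its volume.\<close>

lemma energy_difference_UEG_Jel:
  fixes P :: "(real ^ 'n::finite) set"
  assumes s: "0 < s" "real CARD('n) - 2 < s" "s < real CARD('n)" and R1: "R1 > 0" and k: "k > 0"
    and P: "configuration P" "lattice_periodic R1 P"
    and card: "real (card (P \<inter> cube R1)) = R1 ^ CARD('n)"
  shows "(E_UEG s (cube_measure (k * R1)) (P \<inter> cube (k * R1)) - E_Jel s (cube_measure (k * R1)) (P \<inter> cube (k * R1)))
      / (k * R1) ^ CARD('n) =
    2 / R1 ^ CARD('n) * ((\<Sum>c\<in>cell_points R1 P k. potential_oscillation s R1 k c)
      - (\<integral>x. indicator (cube R1) x * potential_oscillation s R1 k (x :: real ^ 'n) \<partial>lborel))"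
proof -
  let ?R = "real k * R1" and ?C = "cell_points R1 P k"
  let ?L = "lattice_potential s R1 k :: real ^ 'n \<Rightarrow> real" and ?o = "potential_oscillation s R1 k :: real ^ 'n \<Rightarrow> real"
  let ?I = "\<integral>x. indicator (cube R1) x * ?o x \<partial>lborel"
  have "(\<Sum>p\<in>P \<inter> cube ?R. \<integral>y. riesz s (p - y) \<partial>cube_measure ?R) = (\<Sum>p\<in>P \<inter> cube ?R. cube_potential s ?R p)"
    by (simp add: integral_cube_measure cube_potential_def)
  also have "\<dots> = (\<Sum>c\<in>?C. ?L c)"
    unfolding lattice_potential_def by (rule sum_points_eq_sum_cells[OF R1 P])
  also have "\<dots> = (\<Sum>c\<in>?C. ?L 0 + real k ^ CARD('n) * ?o c)"
    using k by (simp add: potential_oscillation_def)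
  also have "\<dots> = R1 ^ CARD('n) * ?L 0 + real k ^ CARD('n) * (\<Sum>c\<in>?C. ?o c)"
    by (simp add: sum.distrib sum_distrib_left card_cell_points[OF R1 P] card)
  finally have sum: "(\<Sum>p\<in>P \<inter> cube ?R. \<integral>y. riesz s (p - y) \<partial>cube_measure ?R) =
    R1 ^ CARD('n) * ?L 0 + real k ^ CARD('n) * (\<Sum>c\<in>?C. ?o c)" .
  have self: "self_energy s (cube_measure ?R :: (real ^ 'n) measure) = R1 ^ CARD('n) * ?L 0 + real k ^ CARD('n) * ?I"
    using self_energy_cube_measure[OF s(1,3) R1, of k] cube_integral_lattice_potential[OF s R1 k, of 0] by simp
  have "E_UEG s (cube_measure ?R) (P \<inter> cube ?R) - E_Jel s (cube_measure ?R) (P \<inter> cube ?R) =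
    2 * (\<Sum>p\<in>P \<inter> cube ?R. \<integral>y. riesz s (p - y) \<partial>cube_measure ?R) - 2 * self_energy s (cube_measure ?R :: (real ^ 'n) measure)"
    by (simp add: E_UEG_def E_Jel_def)
  also have "\<dots> = real k ^ CARD('n) * (2 * ((\<Sum>c\<in>?C. ?o c) - ?I))"
    unfolding sum self by (simp add: algebra_simps)
  finally show ?thesis
    using k by (simp add: power_mult_distrib)
qed

text \<open>Only the two self energies remain. The double sum has as many terms as the square of the
  cell volume by which it is divided, so the baseline cancels again.\<close>

lemma energy_difference_UEG_UEG:
  fixes P :: "(real ^ 'n::finite) set"
  assumes s: "0 < s" "real CARD('n) - 2 < s" "s < real CARD('n)" and R1: "R1 > 0" and k: "k > 0"
    and P: "configuration P" "lattice_periodic R1 P"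
    and card: "real (card (P \<inter> cube R1)) = R1 ^ CARD('n)"
  shows "(E_UEG s (averaged_measure (k * R1) R1 P) (P \<inter> cube (k * R1)) - E_UEG s (cube_measure (k * R1)) (P \<inter> cube (k * R1)))
      / (k * R1) ^ CARD('n) =
    1 / R1 ^ CARD('n) * ((\<integral>x. indicator (cube R1) x * potential_oscillation s R1 k (x :: real ^ 'n) \<partial>lborel)
      - (\<Sum>c\<in>cell_points R1 P k. \<Sum>c'\<in>cell_points R1 P k.
          \<integral>x. indicator (cube R1) x * potential_oscillation s R1 k (x + (c - c')) \<partial>lborel) / (R1 ^ CARD('n))\<^sup>2)"
proof -
  let ?R = "real k * R1" and ?C = "cell_points R1 P k" and ?v = "R1 ^ CARD('n)"
  let ?L = "lattice_potential s R1 k :: real ^ 'n \<Rightarrow> real"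
  let ?I = "\<lambda>v :: real ^ 'n. \<integral>x. indicator (cube R1) x * potential_oscillation s R1 k (x + v) \<partial>lborel"
  have v: "?v > 0"
    using R1 by simp
  have "self_energy s (averaged_measure ?R R1 P) = (\<Sum>c\<in>?C. \<Sum>c'\<in>?C. ?v * ?L 0 + real k ^ CARD('n) * ?I (c - c')) / ?v\<^sup>2"
    unfolding self_energy_averaged_measure[OF s(1,3) R1 P] cube_integral_lattice_potential[OF s R1 k] ..
  also have "(\<Sum>c\<in>?C. \<Sum>c'\<in>?C. ?v * ?L 0 + real k ^ CARD('n) * ?I (c - c')) =
      ?v\<^sup>2 * (?v * ?L 0) + real k ^ CARD('n) * (\<Sum>c\<in>?C. \<Sum>c'\<in>?C. ?I (c - c'))"
    by (simp add: sum.distrib sum_distrib_left card_cell_points[OF R1 P] card power2_eq_square)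
  finally have avg: "self_energy s (averaged_measure ?R R1 P) =
      ?v * ?L 0 + real k ^ CARD('n) * ((\<Sum>c\<in>?C. \<Sum>c'\<in>?C. ?I (c - c')) / ?v\<^sup>2)"
    using v by (simp add: add_divide_distrib)
  have self: "self_energy s (cube_measure ?R :: (real ^ 'n) measure) = ?v * ?L 0 + real k ^ CARD('n) * ?I 0"
    using self_energy_cube_measure[OF s(1,3) R1, of k] cube_integral_lattice_potential[OF s R1 k, of 0] by simp
  have "E_UEG s (averaged_measure ?R R1 P) (P \<inter> cube ?R) - E_UEG s (cube_measure ?R) (P \<inter> cube ?R) =
    self_energy s (cube_measure ?R :: (real ^ 'n) measure) - self_energy s (averaged_measure ?R R1 P)"
    by (simp add: E_UEG_def)
  also have "\<dots> = real k ^ CARD('n) * (?I 0 - (\<Sum>c\<in>?C. \<Sum>c'\<in>?C. ?I (c - c')) / ?v\<^sup>2)"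
    unfolding avg self by (simp add: algebra_simps)
  finally show ?thesis
    using k by (simp add: power_mult_distrib)
qed

text \<open>Copes with index sets that depend on the parity of \<open>k\<close>: with the first
  argument frozen at 0 or 1 the sequences tend to 0, and together they dominate the mixed
  one.\<close>

lemma tendsto_0_mod_2:
  fixes f :: "nat \<Rightarrow> nat \<Rightarrow> real"
  assumes "\<And>m. f m \<longlonglongrightarrow> 0"
  shows "(\<lambda>k. f (k mod 2) k) \<longlonglongrightarrow> 0"
proof (rule Lim_null_comparison)
  have "norm (f (k mod 2) k) \<le> \<bar>f 0 k\<bar> + \<bar>f 1 k\<bar>" for k
    by (cases "even k") (auto simp: odd_iff_mod_2_eq_one)
  then show "\<forall>\<^sub>F k in sequentially. norm (f (k mod 2) k) \<le> \<bar>f 0 k\<bar> + \<bar>f 1 k\<bar>"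
    by simp
  show "(\<lambda>k. \<bar>f 0 k\<bar> + \<bar>f 1 k\<bar>) \<longlonglongrightarrow> 0"
    using tendsto_add[OF tendsto_rabs_zero[OF assms] tendsto_rabs_zero[OF assms]] by simp
qed

lemma tendsto_admissible_at_top:
  assumes R1: "R1 > 0" and F: "(\<lambda>k. F (real k * R1)) \<longlonglongrightarrow> L"
  shows "(F \<longlongrightarrow> L) (admissible_at_top TYPE('n::finite) R1)"
proof (rule topological_tendstoI)
  fix S assume "open S" "L \<in> S"
  then obtain K where K: "\<And>k. k \<ge> K \<Longrightarrow> F (real k * R1) \<in> S"
    using topological_tendstoD[OF F] by (auto simp: eventually_sequentially)
  have "\<forall>\<^sub>F R in at_top. R ^ CARD('n) \<in> \<nat> \<and> R / R1 \<in> \<nat> \<longrightarrow> F R \<in> S"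
    using eventually_ge_at_top[of "real K * R1"]
  proof eventually_elim
    fix R assume R: "real K * R1 \<le> R"
    show "R ^ CARD('n) \<in> \<nat> \<and> R / R1 \<in> \<nat> \<longrightarrow> F R \<in> S"
    proof
      assume "R ^ CARD('n) \<in> \<nat> \<and> R / R1 \<in> \<nat>"
      then obtain k where "R / R1 = real k"
        by (auto elim: Nats_cases)
      then have k: "R = real k * R1"
        using R1 by (simp add: field_simps)
      then have "K \<le> k"
        using R R1 by simp
      then show "F R \<in> S"
        using K k by simp
    qed
  qed
  then show "\<forall>\<^sub>F R in admissible_at_top TYPE('n) R1. F R \<in> S"
    by (simp add: admissible_at_top_def eventually_inf_principal)
qed

section \<open>Mass and first moment of measures with bounded support\<close>

definition has_moments :: "real \<Rightarrow> real \<Rightarrow> real ^ 'n::finite \<Rightarrow> (real ^ 'n) measure \<Rightarrow> bool" where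
  "has_moments B m p M \<longleftrightarrow> finite_measure M \<and> sets M = sets borel \<and> (AE y in M. norm y \<le> B) \<and>
    measure M UNIV = m \<and> (\<integral>y. y \<partial>M) = p"

lemma has_moments_potential:
  fixes M N :: "(real ^ 'n::finite) measure"
  assumes s: "0 < s" "real CARD('n) - 2 < s" "s < real CARD('n)"
    and M: "has_moments A m p M" and N: "has_moments B m p N"
  shows "integrable lborel (potential s (M, N))" "(\<integral>x. potential s (M, N) x \<partial>lborel) = 0"
proof -
  have "AE y in M. norm y \<le> max A B" "AE y in N. norm y \<le> max A B"
    using M N by (auto simp: has_moments_def elim: eventually_mono)
  with M N show "integrable lborel (potential s (M, N))" "(\<integral>x. potential s (M, N) x \<partial>lborel) = 0"
    by (auto simp: has_moments_def intro!: potential_neutral_dipole_free[OF s, where B = "max A B"])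
qed

text \<open>The first moment of a convolution is that of \<open>x + y\<close> under the product
  measure, whence the product rule. In particular, vanishing first moments are preserved.\<close>

lemma has_moments_convolution:
  fixes M N :: "(real ^ 'n::finite) measure"
  assumes M: "has_moments A m p M" and N: "has_moments B n q N"
  shows "has_moments (A + B) (m * n) (n *\<^sub>R p + m *\<^sub>R q) (M \<star> N)"
proof -
  interpret M: finite_measure M using M by (simp add: has_moments_def)
  interpret N: finite_measure N using N by (simp add: has_moments_def)
  interpret pair_sigma_finite M N ..
  have sets [measurable_cong]: "sets M = sets borel" "sets N = sets borel"
    using M N by (simp_all add: has_moments_def)
  have space: "space M = UNIV" "space N = UNIV"
    using sets[THEN sets_eq_imp_space_eq] by simp_all
  have AE: "AE y in M. norm y \<le> A" "AE y in N. norm y \<le> B"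
    using M N by (simp_all add: has_moments_def)
  have intM: "integrable M (\<lambda>y. y)"
    by (rule M.integrable_const_bound[where B = A]) (use AE in auto)
  have intN: "integrable N (\<lambda>y. y)"
    by (rule N.integrable_const_bound[where B = B]) (use AE in auto)
  have fin: "finite_measure (M \<star> N)"
    by (rule convolution_finite) (simp_all add: sets M.finite_measure_axioms N.finite_measure_axioms)
  have AE_pair: "AE z in M \<Otimes>\<^sub>M N. norm (fst z + snd z) \<le> A + B"
  proof (rule AE_pair_measure)
    show "{z \<in> space (M \<Otimes>\<^sub>M N). norm (fst z + snd z) \<le> A + B} \<in> sets (M \<Otimes>\<^sub>M N)"
      by measurable
    show "AE x in M. AE y in N. norm (fst (x, y) + snd (x, y)) \<le> A + B"
      using AE(1)
    proof eventually_elim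
      fix x :: "real ^ 'n" assume x: "norm x \<le> A"
      show "AE y in N. norm (fst (x, y) + snd (x, y)) \<le> A + B"
        using AE(2) by eventually_elim (use x norm_triangle_mono in auto)
    qed
  qed
  then have AE_conv: "AE y in M \<star> N. norm y \<le> A + B"
    unfolding convolution_def by (subst AE_distr_iff) (auto simp: split_beta)
  have "emeasure (M \<star> N) UNIV = emeasure N UNIV * emeasure M UNIV"
    by (subst convolution_emeasure') (auto simp: sets M.finite_measure_axioms N.finite_measure_axioms space)
  then have mass: "measure (M \<star> N) UNIV = m * n"
    using M N by (simp add: has_moments_def measure_def enn2real_mult mult.commute)
  have int: "integrable (M \<Otimes>\<^sub>M N) (\<lambda>z. fst z + snd z)"
  proof -
    interpret MN: finite_measure "M \<Otimes>\<^sub>M N"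
      by (rule finite_measure_pair_measure) unfold_locales
    show ?thesis
      by (rule MN.integrable_const_bound[where B = "A + B"]) (use AE_pair in auto)
  qed
  have "(\<integral>y. y \<partial>(M \<star> N)) = (\<integral>z. fst z + snd z \<partial>(M \<Otimes>\<^sub>M N))"
    unfolding convolution_def by (subst integral_distr) (auto simp: case_prod_beta')
  also have "\<dots> = (\<integral>x. (\<integral>y. x + y \<partial>N) \<partial>M)"
    using integral_fst'[OF int] by simp
  also have "\<dots> = n *\<^sub>R p + m *\<^sub>R q"
    using M N intM intN by (simp add: has_moments_def space)
  finally show ?thesis
    using fin AE_conv mass by (simp add: has_moments_def)
qed

lemma has_moments_return: "has_moments 0 1 0 (return borel (0 :: real ^ 'n::finite))"
proof -
  interpret prob_space "return borel (0 :: real ^ 'n)"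
    by (rule prob_space_return) simp
  show ?thesis
    unfolding has_moments_def
    using prob_space finite_measure_axioms
    by (auto simp: AE_return integral_return space_borel)
qed

lemma has_moments_cube_measure:
  assumes "R \<ge> 0"
  shows "has_moments (real CARD('n) * (R / 2)) (R ^ CARD('n)) 0 (cube_measure R :: (real ^ 'n::finite) measure)"
proof -
  let ?M = "cube_measure R :: (real ^ 'n) measure"
  have em: "emeasure ?M UNIV = ennreal (R ^ CARD('n))"
    using assms by (simp add: cube_measure_def emeasure_density emeasure_cube)
  have space: "space ?M = UNIV"
    by (simp add: cube_measure_def)
  have "(\<integral>y. y \<partial>?M) = (\<integral>y. indicator (cube R) y *\<^sub>R (y :: real ^ 'n) \<partial>lborel)"
    by (simp add: integral_cube_measure)
  also have "\<dots> = (\<integral>y. indicator (cube R) (- y) *\<^sub>R - y \<partial>lborel)"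
    using lborel_integral_affine[of "\<lambda>y. indicator (cube R) y *\<^sub>R (y :: real ^ 'n)" "- 1" 0] by simp
  also have "\<dots> = (\<integral>y. - (indicator (cube R) y *\<^sub>R (y :: real ^ 'n)) \<partial>lborel)"
  proof (rule integral_cong_AE)
    show "AE y in lborel. indicator (cube R) (- y) *\<^sub>R - y = - (indicator (cube R) y *\<^sub>R (y :: real ^ 'n))"
      using AE_cube_uminus[of R, where 'n = 'n] by eventually_elim (simp add: indicator_def)
  qed simp_all
  also have "\<dots> = - (\<integral>y. y \<partial>?M)"
    by (simp add: integral_cube_measure)
  \<comment> \<open>Reflection has shown the first moment to equal its own negative, so its double
    vanishes.\<close>
  finally have "(\<integral>y. y \<partial>?M) = 0"
    by (simp only: eq_neg_iff_add_eq_0 scaleR_2[symmetric] scaleR_eq_0_iff) simp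
  moreover have "AE y in ?M. norm y \<le> real CARD('n) * (R / 2)"
  proof -
    have "norm y \<le> real CARD('n) * (R / 2)" if "indicator (cube R) y > (0 :: ennreal)" for y :: "real ^ 'n"
      using that by (intro norm_cube_le) (simp split: split_indicator_asm)
    then show ?thesis
      unfolding cube_measure_def by (subst AE_density) auto
  qed
  moreover have "finite_measure ?M"
    by standard (simp add: space em)
  moreover have "measure ?M UNIV = R ^ CARD('n)"
    using assms by (simp add: measure_def em)
  moreover have "sets ?M = sets borel"
    by (simp add: cube_measure_def)
  ultimately show ?thesis
    by (simp add: has_moments_def)
qed

lemma sets_dirac_sum [measurable_cong]: "sets (dirac_sum P) = sets borel"
  by (simp add: dirac_sum_def)

lemma integral_dirac_sum:
  fixes f :: "real ^ 'n::finite \<Rightarrow> 'b::{banach, second_countable_topology}"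
  assumes "f \<in> borel_measurable borel"
  shows "(\<integral>x. f x \<partial>dirac_sum P) = (\<integral>x. f x \<partial>count_space P)"
  unfolding dirac_sum_def using assms by (subst integral_distr) auto

lemma has_moments_dirac_sum:
  fixes S :: "(real ^ 'n::finite) set"
  assumes "finite S" "\<And>p. p \<in> S \<Longrightarrow> norm p \<le> B"
  shows "has_moments B (real (card S)) (\<Sum>p\<in>S. p) (dirac_sum S)"
proof -
  have em: "emeasure (dirac_sum S) UNIV = of_nat (card S)"
    using assms(1) by (simp add: emeasure_dirac_sum)
  have space: "space (dirac_sum S) = UNIV"
    by (simp add: dirac_sum_def)
  have "finite_measure (dirac_sum S)"
    by standard (simp add: space em)
  moreover have "AE y in dirac_sum S. norm y \<le> B"
    unfolding dirac_sum_def using assms(2) by (subst AE_distr_iff) (auto simp: AE_count_space)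
  moreover have "(\<integral>y. y \<partial>dirac_sum S) = (\<Sum>p\<in>S. p)"
    using assms(1) by (simp add: integral_dirac_sum lebesgue_integral_count_space_finite)
  ultimately show ?thesis
    using sets_dirac_sum[of S] by (simp add: has_moments_def measure_def em)
qed

text \<open>In this form the rules for densities give integrals and almost everywhere statements for
  rescaled measures.\<close>

lemma scale_measure_eq_density: "scale_measure r M = density M (\<lambda>_. r)"
  by (rule measure_eqI) (auto simp: emeasure_density_const)

lemma has_moments_scale_measure:
  fixes M :: "(real ^ 'n::finite) measure"
  assumes M: "has_moments B m p M" and r: "r \<ge> 0"
  shows "has_moments B (r * m) (r *\<^sub>R p) (scale_measure (ennreal r) M)"
proof -
  interpret M: finite_measure M using M by (simp add: has_moments_def)
  have [measurable_cong]: "sets M = sets borel"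
    using M by (simp add: has_moments_def)
  have space: "space M = UNIV"
    using sets_eq_imp_space_eq[OF \<open>sets M = sets borel\<close>] by simp
  have "finite_measure (scale_measure (ennreal r) M)"
    by standard (simp add: space_scale_measure ennreal_mult_eq_top_iff)
  moreover have "AE y in scale_measure (ennreal r) M. norm y \<le> B"
    unfolding scale_measure_eq_density using M by (subst AE_density) (auto simp: has_moments_def)
  moreover have "(\<integral>y. y \<partial>scale_measure (ennreal r) M) = r *\<^sub>R p"
    unfolding scale_measure_eq_density using M r by (subst integral_density) (auto simp: has_moments_def)
  ultimately show ?thesis
    using M r by (simp add: has_moments_def measure_def enn2real_mult)
qed

theorem lemma3p2:
  fixes s R1 :: real and P :: "(real ^ 'n::finite) set"
  assumes "CARD('n) \<ge> 2"
    and "real CARD('n) - 2 < s" and "s < real CARD('n)"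
    and "R1 > 0" and "R1 ^ CARD('n) \<in> \<nat>"
    and "configuration P" and "lattice_periodic R1 P"
    and "real (card (P \<inter> cube R1)) = R1 ^ CARD('n)"
    and "(LINT x:cube R1|dirac_sum P. x) = 0"
  shows
    "integrable lborel (potential s (dirac_sum (P \<inter> cube R1), cube_measure R1)) \<and>
     ((\<lambda>R. (E_UEG s (cube_measure R) (P \<inter> cube R) - E_Jel s (cube_measure R) (P \<inter> cube R))
            / R ^ CARD('n))
       \<longlongrightarrow> 2 / measure lborel (cube R1 :: (real ^ 'n) set) *
         (\<integral>x. potential s (dirac_sum (P \<inter> cube R1), cube_measure R1) x \<partial>lborel))
       (admissible_at_top TYPE('n) R1) \<and>
     integrable lborel (potential s (signed_convolution
         (return borel 0, normalized_cell R1 P \<star> normalized_cell R1 P) (cube_measure R1))) \<and>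
     ((\<lambda>R. (E_UEG s (averaged_measure R R1 P) (P \<inter> cube R) - E_UEG s (cube_measure R) (P \<inter> cube R))
            / R ^ CARD('n))
       \<longlongrightarrow> 1 / measure lborel (cube R1 :: (real ^ 'n) set) *
         (\<integral>x. potential s (signed_convolution
            (return borel 0, normalized_cell R1 P \<star> normalized_cell R1 P) (cube_measure R1)) x \<partial>lborel))
       (admissible_at_top TYPE('n) R1)"
proof -
  have s: "0 < s" "real CARD('n) - 2 < s" "s < real CARD('n)"
    using assms(1-3) by linarith+
  note R1 = assms(4) and P = assms(6,7) and card = assms(8)
  let ?S = "P \<inter> cube R1" and ?v = "R1 ^ CARD('n)" and ?B = "real CARD('n) * (R1 / 2)"
  have v: "?v > 0"
    using R1 by simp
  have fin: "finite ?S"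
    using P(1) bounded_cube by (auto simp: configuration_def)
  have "(LINT x:cube R1|dirac_sum P. x) = (\<integral>x. indicator (cube R1) x *\<^sub>R x \<partial>count_space P)"
    unfolding set_lebesgue_integral_def by (subst integral_dirac_sum) auto
  \<comment> \<open>\<open>P\<close> itself need not be finite, but the integrand lives on the
    finitely many points in the cube. The origin drops out of this index set and returns in the next
    step with a zero summand.\<close>
  also have "\<dots> = (\<Sum>x | x \<in> P \<and> indicator (cube R1) x *\<^sub>R x \<noteq> 0. indicator (cube R1) x *\<^sub>R x)"
    by (rule lebesgue_integral_count_space_finite_support)
      (rule finite_subset[OF _ fin], auto simp: indicator_def split: if_splits)
  also have "\<dots> = (\<Sum>x\<in>?S. x)"
    using fin by (intro sum.mono_neutral_cong_left) (auto simp: indicator_def split: if_splits)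
  finally have dipole: "(\<Sum>x\<in>?S. x) = 0"
    using assms(9) by simp

  have \<mu>: "has_moments ?B ?v 0 (cube_measure R1 :: (real ^ 'n) measure)"
    using R1 by (intro has_moments_cube_measure) simp
  have \<nu>: "has_moments ?B ?v 0 (dirac_sum ?S)"
    using has_moments_dirac_sum[OF fin, of ?B] norm_cube_le[where R = R1] by (auto simp: card dipole)
  have "1 / ennreal ?v = ennreal (1 / ?v)"
    using v divide_ennreal[of 1 ?v] by simp
  then have \<nu>1: "has_moments ?B 1 0 (normalized_cell R1 P)"
    using has_moments_scale_measure[OF \<nu>, of "1 / ?v"] v R1
    by (simp add: normalized_cell_def emeasure_cube)
  have \<delta>\<mu>: "has_moments (0 + ?B) ?v 0 (return borel (0 :: real ^ 'n) \<star> cube_measure R1)"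
    using has_moments_convolution[OF has_moments_return \<mu>] by simp
  \<comment> \<open>The normalised cell is a probability measure with first moment 0, so convolving
    with it twice changes neither the mass nor the first moment of the background.\<close>
  have \<nu>\<nu>\<mu>: "has_moments (?B + ?B + ?B) ?v 0 ((normalized_cell R1 P \<star> normalized_cell R1 P) \<star> cube_measure R1)"
    using has_moments_convolution[OF has_moments_convolution[OF \<nu>1 \<nu>1] \<mu>] by simp
  note pot1 = has_moments_potential[OF s \<nu> \<mu>]
  note pot2 = has_moments_potential[OF s \<delta>\<mu> \<nu>\<nu>\<mu>]

  let ?I = "\<lambda>k (v :: real ^ 'n). \<integral>x. indicator (cube R1) x * potential_oscillation s R1 k (x + v) \<partial>lborel"
  have I: "(\<lambda>k. ?I k v) \<longlonglongrightarrow> 0" for v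
    by (rule potential_oscillation_cube_integral_tendsto[OF s R1])
  have lim1: "((\<lambda>R. (E_UEG s (cube_measure R) (P \<inter> cube R) - E_Jel s (cube_measure R) (P \<inter> cube R))
      / R ^ CARD('n)) \<longlongrightarrow> 0) (admissible_at_top TYPE('n) R1)"
  proof (rule tendsto_admissible_at_top[OF R1])
    have sum: "(\<lambda>k. \<Sum>c\<in>cell_points R1 P (k mod 2). potential_oscillation s R1 k c) \<longlonglongrightarrow> 0"
      by (rule tendsto_0_mod_2) (intro tendsto_null_sum potential_oscillation_tendsto[OF s R1])
    have "(\<lambda>k. 2 / ?v * ((\<Sum>c\<in>cell_points R1 P (k mod 2). potential_oscillation s R1 k c) - ?I k 0))
        \<longlonglongrightarrow> 2 / ?v * (0 - 0)"
      by (intro tendsto_mult tendsto_diff tendsto_const sum I)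
    then have "(\<lambda>k. 2 / ?v * ((\<Sum>c\<in>cell_points R1 P (k mod 2). potential_oscillation s R1 k c) - ?I k 0))
        \<longlonglongrightarrow> 0"
      by simp
    \<comment> \<open>The exact formula is available for \<open>k > 0\<close>, so the sequences
      agree eventually, once the pattern for \<open>k\<close> is identified with that for its
      parity.\<close>
    then show "(\<lambda>k. (E_UEG s (cube_measure (k * R1)) (P \<inter> cube (k * R1)) - E_Jel s (cube_measure (k * R1)) (P \<inter> cube (k * R1)))
      / (real k * R1) ^ CARD('n)) \<longlonglongrightarrow> 0"
      by (rule Lim_transform_eventually)
        (use eventually_gt_at_top[of 0] in eventually_elim,
          simp add: energy_difference_UEG_Jel[OF s R1 _ P card] cell_points_mod_2[OF P(2), symmetric])
  qed
  have lim2: "((\<lambda>R. (E_UEG s (averaged_measure R R1 P) (P \<inter> cube R) - E_UEG s (cube_measure R) (P \<inter> cube R))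
      / R ^ CARD('n)) \<longlongrightarrow> 0) (admissible_at_top TYPE('n) R1)"
  proof (rule tendsto_admissible_at_top[OF R1])
    have sum: "(\<lambda>k. \<Sum>c\<in>cell_points R1 P (k mod 2). \<Sum>c'\<in>cell_points R1 P (k mod 2). ?I k (c - c')) \<longlonglongrightarrow> 0"
      by (rule tendsto_0_mod_2) (intro tendsto_null_sum I)
    have "(\<lambda>k. 1 / ?v * (?I k 0 - (\<Sum>c\<in>cell_points R1 P (k mod 2). \<Sum>c'\<in>cell_points R1 P (k mod 2). ?I k (c - c')) / ?v\<^sup>2))
        \<longlonglongrightarrow> 1 / ?v * (0 - 0)"
      by (intro tendsto_mult tendsto_diff tendsto_const tendsto_divide_zero sum I)
    then have "(\<lambda>k. 1 / ?v * (?I k 0 - (\<Sum>c\<in>cell_points R1 P (k mod 2). \<Sum>c'\<in>cell_points R1 P (k mod 2). ?I k (c - c')) / ?v\<^sup>2))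
        \<longlonglongrightarrow> 0"
      by simp
    then show "(\<lambda>k. (E_UEG s (averaged_measure (k * R1) R1 P) (P \<inter> cube (k * R1)) - E_UEG s (cube_measure (k * R1)) (P \<inter> cube (k * R1)))
      / (real k * R1) ^ CARD('n)) \<longlonglongrightarrow> 0"
      by (rule Lim_transform_eventually)
        (use eventually_gt_at_top[of 0] in eventually_elim,
          simp add: energy_difference_UEG_UEG[OF s R1 _ P card] cell_points_mod_2[OF P(2), symmetric])
  qed
  show ?thesis
    \<comment> \<open>The integrals on the right vanish by \<open>pot1\<close> and
      \<open>pot2\<close>, so the claimed limits are the zeros just obtained.\<close>
    using pot1 pot2 lim1 lim2 by (simp add: signed_convolution_def)
qed

end
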